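(* Let $M=G/K$ be a Riemannian symmetric space of compact type, with $\mathfrak{g},\sigma,\mathfrak{t},\Delta,(X_\alpha),(c_{\alpha,\beta}),(s_\alpha)$ as in the context. For any $\alpha\in\Delta$ and $z\in\mathbb{C}$ put $V_\alpha(z):=\tfrac1{\sqrt2}\bigl(zX_\alpha-\overline{z}X_{-\alpha}\bigr)$, and put $V_\alpha(z):=0$ whenever $\alpha$ is a linear form which is not a root. Then for any $\alpha,\beta\in\Delta$: (a) $\mathfrak{g}_\alpha=\{V_\alpha(z):z\in\mathbb{C}\}$. (b) For $H\in\mathfrak{t}$ and $z,z'\in\mathbb{C}$ we have $[H,V_\alpha(z)]=V_\alpha(\alpha(H)z)$ and $$[V_\alpha(z),V_\beta(z')]=\begin{cases}\tfrac1{\sqrt2}\bigl(c_{\alpha,\beta}V_{\alpha+\beta}(zz')-c_{\alpha,-\beta}V_{\alpha-\beta}(z\overline{z'})\bigr)&\text{for }\beta\notin\{\pm\alpha\}\\ \mathrm{Im}(\overline{z}z')\,i\alpha^\sharp&\text{for }\beta=\alpha\\ \mathrm{Im}(zz')\,i\alpha^\sharp&\text{for }\beta=-\alpha.\end{cases}$$ (c) With respect to the inner product $\langle\cdot,\cdot\rangle=-\kappa$ on $\mathfrak{g}$: $\mathfrak{t}$ is orthogonal to $\mathfrak{g}_\alpha$ for every $\alpha\in\Delta$; $\mathfrak{g}_\alpha$ and $\mathfrak{g}_\beta$ are orthogonal whenever $\alpha\notin\{\pm\beta\}$; and for all $z,z'\in\mathbb{C}$, $\langle V_\alpha(z),V_\alpha(z')\rangle=\mathrm{Re}(z\,\overline{z'})$.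 (d) For any $z\in\mathbb{C}$, $\sigma(V_\alpha(z))=s_\alpha\,V_{\sigma(\alpha)}(z)$.
   Context: Setting. $\mathfrak{g}$ is the Lie algebra of the transvection group $G$ (its Killing form $\kappa$ is negative definite), $\sigma$ the involutive automorphism of $\mathfrak{g}$ given by the symmetric structure, also extended complex-linearly to $\mathfrak{g}^{\mathbb{C}}$; $\mathfrak{k}=\mathrm{Eig}(\sigma,1)$, $\mathfrak{m}=\mathrm{Eig}(\sigma,-1)$; $\mathfrak{a}\subset\mathfrak{m}$ is a maximal flat (abelian) subspace and $\mathfrak{t}\supset\mathfrak{a}$ a Cartan subalgebra of $\mathfrak{g}$; then $\sigma(\mathfrak{t})=\mathfrak{t}$. $\Delta\subset(\mathfrak{t}^{\mathbb{C}})^*$ is the root system (roots are purely imaginary on $\mathfrak{t}$), $\mathfrak{g}_\alpha=\{X\in\mathfrak{g}:\mathrm{ad}(H)^2X=\alpha(H)^2X\ \forall H\in\mathfrak{t}\}$. $\kappa$ also denotes the complex-bilinear extension to $\mathfrak{g}^{\mathbb{C}}$; $\alpha^\sharp\in i\mathfrak{t}$ is defined by $\kappa(\alpha^\sharp,\cdot)=\alpha$ on $\mathfrak{t}$, and $\sigma(\alpha):=\alpha\circ\sigma^{-1}$. $X\mapsto\overline X$ is the conjugation of $\mathfrak{g}^{\mathbb{C}}$ with respect to $\mathfrak{g}$. Satake's description. $\Delta_+$ with simple roots $\Pi$ is chosen so that $\Pi=\{\alpha_1,\dots,\alpha_r\}\,\dot\cup\,\{\beta_1,\dots,\beta_s\}$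 (white and black roots) and there is an involutive permutation $\pi$ of $\{1,\dots,r\}$ with $\sigma(\alpha_k^\sharp)=-\alpha_{\pi(k)}^\sharp-\sum_{j=1}^s n_{kj}\beta_j^\sharp$ for certain integers $n_{kj}\ge0$, and $\sigma(\beta_k^\sharp)=\beta_k^\sharp$. Chevalley basis. $(X_\alpha)_{\alpha\in\Delta}$ with $X_\alpha\in\mathfrak{g}^{\mathbb{C}}_\alpha$ (root space of $\mathfrak g^{\mathbb C}$) and real constants $c_{\alpha,\beta}$ satisfies $[X_\alpha,X_\beta]=c_{\alpha,\beta}X_{\alpha+\beta}$ if $\alpha+\beta\in\Delta$, $[X_\alpha,X_{-\alpha}]=\alpha^\sharp$, $[X_\alpha,X_\beta]=0$ otherwise, and $c_{-\alpha,-\beta}=-c_{\alpha,\beta}$ (with $c_{\alpha,\beta}:=0$ if $\alpha+\beta\notin\Delta\cup\{0\}$). Moreover $X_{-\alpha}=-\overline{X_\alpha}$ for all $\alpha$, and, for a fixed family of decompositions $\alpha=\zeta_\alpha+\eta_\alpha$ ($\zeta_\alpha,\eta_\alpha\in\Delta_+$) of the non-simple positive roots, $c_{\zeta_\alpha,\eta_\alpha}>0$. The numbers $s_\alpha$ are defined by $\sigma(X_\alpha)=s_\alpha X_{\sigma(\alpha)}$. Normalization of $\sigma$. It is assumed that, on each irreducible factor of $M$ separately: if the factor is of type $\mathsf{AIII}(n,q)=\mathrm{SU}(n)/\mathrm{S}(\mathrm{U}(q)\times\mathrm{U}(n-q))$ with $2q<n-1$, $\mathsf{DIII}(n)=\mathrm{SO}(2n)/\mathrm{U}(n)$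 with $n$ odd, or $\mathsf{EIII}=E_6/(\mathrm{U}(1)\cdot\mathrm{SO}(10))$, then $s_{\alpha_{\pi(1)}}=c_{\beta,\alpha_1}/c_{\alpha_{\pi(1)},\beta}$ and $s_{\alpha_k}=1$ for $k\ne\pi(1)$; for any other type $s_{\alpha_k}=1$ for all $k$. Here: for $\mathsf{AIII}(n,q)$ the Dynkin diagram is the chain $\alpha_q,\dots,\alpha_1,\beta_1,\dots,\beta_s,\alpha_{\pi(1)},\dots,\alpha_{\pi(q)}$ and $\beta=\beta_1+\dots+\beta_s$; for $\mathsf{DIII}(n)$, $\alpha_1,\alpha_{\pi(1)}$ are the two end nodes of the fork of $D_n$ and $\beta$ is the (black) branch node adjacent to both; for $\mathsf{EIII}$ the diagram is the chain $\alpha_1,\beta_1,\beta_2,\beta_3,\alpha_{\pi(1)}$ with $\alpha_2$ attached to $\beta_2$, and $\beta=\beta_1+\beta_2+\beta_3$. With this normalization $s_\alpha\in\{\pm1\}$ for all $\alpha\in\Delta$. *)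

theory Defs
  imports
    "HOL-Analysis.Analysis"
    "HOL-Library.Function_Algebras"
    "Jordan_Normal_Form.Matrix"
begin

section \<open>Real Lie algebras and their complexification\<close>

text \<open>
  A finite-dimensional real Lie algebra is a bracket on a type of class \<open>euclidean_space\<close>. The
  inner product of the class only provides the (basis independent) trace; it is unrelated to the
  bracket.
\<close>

definition lie_bracket :: "('g::euclidean_space \<Rightarrow> 'g \<Rightarrow> 'g) \<Rightarrow> bool" where
  "lie_bracket br \<longleftrightarrow> bilinear br \<and> (\<forall>x. br x x = 0) \<and>
     (\<forall>x y z. br x (br y z) + br y (br z x) + br z (br x y) = 0)"

definition trace_end :: "('g::euclidean_space \<Rightarrow> 'g) \<Rightarrow> real" where
  "trace_end f = (\<Sum>b\<in>Basis. f b \<bullet> b)"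

definition killing :: "('g::euclidean_space \<Rightarrow> 'g \<Rightarrow> 'g) \<Rightarrow> 'g \<Rightarrow> 'g \<Rightarrow> real" where
  "killing br x y = trace_end (\<lambda>z. br x (br y z))"

text \<open>The pair \<open>(x, y)\<close> stands for \<open>x + i y\<close>.\<close>

type_synonym 'g cplx = "'g \<times> 'g"

text \<open>Linear forms on the complexified Cartan subalgebra are total functions that vanish outside
  it, so that they can be compared, added and negated as functions.\<close>

type_synonym 'g form = "'g cplx \<Rightarrow> complex"

definition emb :: "'g::real_vector \<Rightarrow> 'g cplx" where
  "emb x = (x, 0)"

definition cscale :: "complex \<Rightarrow> 'g::real_vector cplx \<Rightarrow> 'g cplx" (infixr \<open>*\<^sub>C\<close> 75) where
  "z *\<^sub>C v = (Re z *\<^sub>R fst v - Im z *\<^sub>R snd v, Re z *\<^sub>R snd v + Im z *\<^sub>R fst v)"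

definition conj_cplx :: "'g::real_vector cplx \<Rightarrow> 'g cplx" where
  "conj_cplx v = (fst v, - snd v)"

definition br_cplx :: "('g::euclidean_space \<Rightarrow> 'g \<Rightarrow> 'g) \<Rightarrow> 'g cplx \<Rightarrow> 'g cplx \<Rightarrow> 'g cplx" where
  "br_cplx br v w = (br (fst v) (fst w) - br (snd v) (snd w),
                     br (fst v) (snd w) + br (snd v) (fst w))"

definition lin_cplx :: "('g \<Rightarrow> 'g) \<Rightarrow> 'g::real_vector cplx \<Rightarrow> 'g cplx" where
  "lin_cplx f v = (f (fst v), f (snd v))"

definition killing_cplx :: "('g::euclidean_space \<Rightarrow> 'g \<Rightarrow> 'g) \<Rightarrow> 'g cplx \<Rightarrow> 'g cplx \<Rightarrow> complex" where
  "killing_cplx br v w =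
     Complex (killing br (fst v) (fst w) - killing br (snd v) (snd w))
             (killing br (fst v) (snd w) + killing br (snd v) (fst w))"

section \<open>Symmetric Lie algebras of compact type\<close>

text \<open>
  The infinitesimal datum of a Riemannian symmetric space \<open>M = G/K\<close> of compact type. The last
  conjunct, \<open>[\<mm>, \<mm>] = \<kk>\<close>, says that \<open>\<gg> = [\<mm>, \<mm>] \<oplus> \<mm>\<close> is the Lie algebra of the
  transvection group.
\<close>

definition compact_symmetric_lie_algebra ::
  "('g::euclidean_space \<Rightarrow> 'g \<Rightarrow> 'g) \<Rightarrow> ('g \<Rightarrow> 'g) \<Rightarrow> bool" where
  "compact_symmetric_lie_algebra br \<sigma> \<longleftrightarrow>
     lie_bracket br \<and>
     (\<forall>x. x \<noteq> 0 \<longrightarrow> killing br x x < 0) \<and>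
     linear \<sigma> \<and> (\<forall>x y. \<sigma> (br x y) = br (\<sigma> x) (\<sigma> y)) \<and> (\<forall>x. \<sigma> (\<sigma> x) = x) \<and>
     span {br x y | x y. \<sigma> x = - x \<and> \<sigma> y = - y} = {x. \<sigma> x = x}"

definition abelian_subspace :: "('g::euclidean_space \<Rightarrow> 'g \<Rightarrow> 'g) \<Rightarrow> 'g set \<Rightarrow> bool" where
  "abelian_subspace br V \<longleftrightarrow> subspace V \<and> (\<forall>x\<in>V. \<forall>y\<in>V. br x y = 0)"

definition maximal_abelian_in ::
  "('g::euclidean_space \<Rightarrow> 'g \<Rightarrow> 'g) \<Rightarrow> 'g set \<Rightarrow> 'g set \<Rightarrow> bool" where
  "maximal_abelian_in br U V \<longleftrightarrow> V \<subseteq> U \<and> abelian_subspace br V \<and>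
     (\<forall>W. W \<subseteq> U \<and> abelian_subspace br W \<and> V \<subseteq> W \<longrightarrow> W = V)"

text \<open>In a compact Lie algebra the Cartan subalgebras are the maximal abelian ones.\<close>

abbreviation cartan_subalgebra :: "('g::euclidean_space \<Rightarrow> 'g \<Rightarrow> 'g) \<Rightarrow> 'g set \<Rightarrow> bool" where
  "cartan_subalgebra br \<tt> \<equiv> maximal_abelian_in br UNIV \<tt>"

section \<open>Roots\<close>

definition forms :: "'g::euclidean_space set \<Rightarrow> 'g form set" where
  "forms \<tt> = {\<alpha>. (\<forall>v\<in>\<tt> \<times> \<tt>. \<forall>w\<in>\<tt> \<times> \<tt>. \<alpha> (v + w) = \<alpha> v + \<alpha> w) \<and>
                 (\<forall>z. \<forall>v\<in>\<tt> \<times> \<tt>. \<alpha> (z *\<^sub>C v) = z * \<alpha> v) \<and>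
                 (\<forall>v. v \<notin> \<tt> \<times> \<tt> \<longrightarrow> \<alpha> v = 0)}"

definition root_space_cplx ::
  "('g::euclidean_space \<Rightarrow> 'g \<Rightarrow> 'g) \<Rightarrow> 'g set \<Rightarrow> 'g form \<Rightarrow> 'g cplx set" where
  "root_space_cplx br \<tt> \<alpha> = {X. \<forall>H\<in>\<tt> \<times> \<tt>. br_cplx br H X = \<alpha> H *\<^sub>C X}"

definition roots :: "('g::euclidean_space \<Rightarrow> 'g \<Rightarrow> 'g) \<Rightarrow> 'g set \<Rightarrow> 'g form set" where
  "roots br \<tt> = {\<alpha> \<in> forms \<tt>. \<alpha> \<noteq> 0 \<and> root_space_cplx br \<tt> \<alpha> \<noteq> {0}}"

text \<open>The real root space; \<open>\<alpha> H\<close> is imaginary for \<open>H\<close> in \<open>\<tt>\<close>, so \<open>\<alpha> H ^ 2\<close> is a real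
  number.\<close>

definition root_space ::
  "('g::euclidean_space \<Rightarrow> 'g \<Rightarrow> 'g) \<Rightarrow> 'g set \<Rightarrow> 'g form \<Rightarrow> 'g set" where
  "root_space br \<tt> \<alpha> = {X. \<forall>H\<in>\<tt>. emb (br H (br H X)) = (\<alpha> (emb H))\<^sup>2 *\<^sub>C emb X}"

text \<open>The element of \<open>i \<tt>\<close> dual to \<open>\<alpha>\<close>; \<open>(0, y)\<close> is \<open>i y\<close>.\<close>

definition sharp ::
  "('g::euclidean_space \<Rightarrow> 'g \<Rightarrow> 'g) \<Rightarrow> 'g set \<Rightarrow> 'g form \<Rightarrow> 'g cplx" where
  "sharp br \<tt> \<alpha> = (THE v. v \<in> {0} \<times> \<tt> \<and> (\<forall>H\<in>\<tt>. killing_cplx br v (emb H) = \<alpha> (emb H)))"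

definition act :: "('g::euclidean_space \<Rightarrow> 'g) \<Rightarrow> 'g form \<Rightarrow> 'g form" where
  "act \<sigma> \<alpha> = \<alpha> \<circ> inv_into UNIV (lin_cplx \<sigma>)"

text \<open>A system of positive roots is cut out by a regular element \<open>i H\<close> of \<open>i \<tt>\<close>, on which
  the roots are real.\<close>

definition positive_system ::
  "('g::euclidean_space \<Rightarrow> 'g \<Rightarrow> 'g) \<Rightarrow> 'g set \<Rightarrow> 'g form set \<Rightarrow> bool" where
  "positive_system br \<tt> P \<longleftrightarrow>
     (\<exists>H\<in>\<tt>. (\<forall>\<alpha>\<in>roots br \<tt>. \<alpha> (0, H) \<noteq> 0) \<and> P = {\<alpha>\<in>roots br \<tt>. 0 < Re (\<alpha> (0, H))})"

definition simple_roots :: "'g::euclidean_space form set \<Rightarrow> 'g form set" where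
  "simple_roots P = {\<alpha>\<in>P. \<not> (\<exists>\<beta>\<in>P. \<exists>\<gamma>\<in>P. \<alpha> = \<beta> + \<gamma>)}"

section \<open>Satake's description and the Chevalley basis\<close>

definition satake_description ::
  "('g::euclidean_space \<Rightarrow> 'g \<Rightarrow> 'g) \<Rightarrow> ('g \<Rightarrow> 'g) \<Rightarrow> 'g set \<Rightarrow> 'g form set \<Rightarrow> nat \<Rightarrow> nat \<Rightarrow>
    (nat \<Rightarrow> 'g form) \<Rightarrow> (nat \<Rightarrow> 'g form) \<Rightarrow> (nat \<Rightarrow> nat) \<Rightarrow> (nat \<Rightarrow> nat \<Rightarrow> nat) \<Rightarrow> bool" where
  "satake_description br \<sigma> \<tt> P r s white black \<pi> n \<longleftrightarrow>
     positive_system br \<tt> P \<and>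
     inj_on white {1..r} \<and> inj_on black {1..s} \<and> white ` {1..r} \<inter> black ` {1..s} = {} \<and>
     simple_roots P = white ` {1..r} \<union> black ` {1..s} \<and>
     \<pi> permutes {1..r} \<and> (\<forall>k\<in>{1..r}. \<pi> (\<pi> k) = k) \<and>
     (\<forall>k\<in>{1..r}. lin_cplx \<sigma> (sharp br \<tt> (white k)) =
        - sharp br \<tt> (white (\<pi> k)) - (\<Sum>j=1..s. real (n k j) *\<^sub>R sharp br \<tt> (black j))) \<and>
     (\<forall>k\<in>{1..s}. lin_cplx \<sigma> (sharp br \<tt> (black k)) = sharp br \<tt> (black k))"

definition chevalley_basis ::
  "('g::euclidean_space \<Rightarrow> 'g \<Rightarrow> 'g) \<Rightarrow> 'g set \<Rightarrow> 'g form set \<Rightarrow> ('g form \<Rightarrow> 'g cplx) \<Rightarrow>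
    ('g form \<Rightarrow> 'g form \<Rightarrow> real) \<Rightarrow> ('g form \<Rightarrow> 'g form) \<Rightarrow> ('g form \<Rightarrow> 'g form) \<Rightarrow> bool" where
  "chevalley_basis br \<tt> P X c \<zeta> \<eta> \<longleftrightarrow>
     (\<forall>\<alpha>\<in>roots br \<tt>. X \<alpha> \<in> root_space_cplx br \<tt> \<alpha> \<and> X (- \<alpha>) = - conj_cplx (X \<alpha>) \<and>
        br_cplx br (X \<alpha>) (X (- \<alpha>)) = sharp br \<tt> \<alpha>) \<and>
     (\<forall>\<alpha>\<in>roots br \<tt>. \<forall>\<beta>\<in>roots br \<tt>. \<alpha> + \<beta> \<in> roots br \<tt> \<longrightarrow>
        br_cplx br (X \<alpha>) (X \<beta>) = complex_of_real (c \<alpha> \<beta>) *\<^sub>C X (\<alpha> + \<beta>) \<and>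
        c (- \<alpha>) (- \<beta>) = - c \<alpha> \<beta>) \<and>
     (\<forall>\<alpha>\<in>roots br \<tt>. \<forall>\<beta>\<in>roots br \<tt>. \<alpha> + \<beta> \<notin> roots br \<tt> \<union> {0} \<longrightarrow>
        br_cplx br (X \<alpha>) (X \<beta>) = 0 \<and> c \<alpha> \<beta> = 0) \<and>
     (\<forall>\<alpha>\<in>P - simple_roots P. \<zeta> \<alpha> \<in> P \<and> \<eta> \<alpha> \<in> P \<and> \<alpha> = \<zeta> \<alpha> + \<eta> \<alpha> \<and> c (\<zeta> \<alpha>) (\<eta> \<alpha>) > 0)"

section \<open>Irreducible factors and their types\<close>

definition invariant_ideal ::
  "('g::euclidean_space \<Rightarrow> 'g \<Rightarrow> 'g) \<Rightarrow> ('g \<Rightarrow> 'g) \<Rightarrow> 'g set \<Rightarrow> bool" where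
  "invariant_ideal br \<sigma> h \<longleftrightarrow> subspace h \<and> (\<forall>x. \<forall>y\<in>h. br x y \<in> h) \<and> \<sigma> ` h \<subseteq> h"

text \<open>The irreducible factors of \<open>M\<close> correspond to the minimal \<open>\<sigma>\<close>-invariant ideals
  of \<open>\<gg>\<close> (these need not be simple: consider \<open>M\<close> a simple Lie group).\<close>

definition irreducible_factor ::
  "('g::euclidean_space \<Rightarrow> 'g \<Rightarrow> 'g) \<Rightarrow> ('g \<Rightarrow> 'g) \<Rightarrow> 'g set \<Rightarrow> bool" where
  "irreducible_factor br \<sigma> h \<longleftrightarrow> invariant_ideal br \<sigma> h \<and> h \<noteq> {0} \<and>
     (\<forall>h'. invariant_ideal br \<sigma> h' \<and> h' \<subseteq> h \<longrightarrow> h' = {0} \<or> h' = h)"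

definition factor_simple_roots ::
  "('g::euclidean_space \<Rightarrow> 'g \<Rightarrow> 'g) \<Rightarrow> 'g set \<Rightarrow> 'g form set \<Rightarrow> 'g set \<Rightarrow> 'g form set" where
  "factor_simple_roots br \<tt> P h = {\<alpha>\<in>simple_roots P. root_space_cplx br \<tt> \<alpha> \<subseteq> h \<times> h}"

text \<open>\<open>h\<close> with the involution \<open>\<sigma>\<close> is isomorphic to the matrix Lie algebra \<open>L\<close> with the
  involution \<open>\<tau>\<close>.\<close>

definition matrix_model ::
  "('g::euclidean_space \<Rightarrow> 'g \<Rightarrow> 'g) \<Rightarrow> ('g \<Rightarrow> 'g) \<Rightarrow> 'g set \<Rightarrow>
    'f::{real_algebra_1, comm_ring_1} mat set \<Rightarrow> ('f mat \<Rightarrow> 'f mat) \<Rightarrow> bool" where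
  "matrix_model br \<sigma> h L \<tau> \<longleftrightarrow>
     (\<exists>\<phi>. bij_betw \<phi> h L \<and>
        (\<forall>x\<in>h. \<forall>y\<in>h. \<phi> (x + y) = \<phi> x + \<phi> y \<and> \<phi> (br x y) = \<phi> x * \<phi> y - \<phi> y * \<phi> x) \<and>
        (\<forall>x\<in>h. (\<forall>r. \<phi> (r *\<^sub>R x) = of_real r \<cdot>\<^sub>m \<phi> x) \<and> \<phi> (\<sigma> x) = \<tau> (\<phi> x)))"

definition su_mats :: "nat \<Rightarrow> complex mat set" where
  "su_mats n = {A \<in> carrier_mat n n. (\<forall>i<n. \<forall>j<n. A $$ (j, i) = - cnj (A $$ (i, j))) \<and>
                  (\<Sum>i<n. A $$ (i, i)) = 0}"

definition so_mats :: "nat \<Rightarrow> real mat set" where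
  "so_mats n = {A \<in> carrier_mat n n. transpose_mat A = - A}"

definition signature_mat :: "nat \<Rightarrow> nat \<Rightarrow> complex mat" where
  "signature_mat n q = mat n n (\<lambda>(i, j). if i = j then (if i < q then 1 else - 1) else 0)"

definition complex_structure_mat :: "nat \<Rightarrow> real mat" where
  "complex_structure_mat n = four_block_mat (0\<^sub>m n n) (- 1\<^sub>m n) (1\<^sub>m n) (0\<^sub>m n n)"

text \<open>\<open>SU(n) / S(U(q) \<times> U(n - q))\<close>; note that \<open>signature_mat n q\<close> is its own inverse.\<close>

definition type_AIII ::
  "('g::euclidean_space \<Rightarrow> 'g \<Rightarrow> 'g) \<Rightarrow> ('g \<Rightarrow> 'g) \<Rightarrow> 'g set \<Rightarrow> nat \<Rightarrow> nat \<Rightarrow> bool" where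
  "type_AIII br \<sigma> h n q \<longleftrightarrow> 1 \<le> q \<and> q < n \<and>
     matrix_model br \<sigma> h (su_mats n) (\<lambda>A. signature_mat n q * A * signature_mat n q)"

text \<open>\<open>SO(2 n) / U(n)\<close>; the inverse of \<open>complex_structure_mat n\<close> is its transpose.\<close>

definition type_DIII ::
  "('g::euclidean_space \<Rightarrow> 'g \<Rightarrow> 'g) \<Rightarrow> ('g \<Rightarrow> 'g) \<Rightarrow> 'g set \<Rightarrow> nat \<Rightarrow> bool" where
  "type_DIII br \<sigma> h n \<longleftrightarrow>
     matrix_model br \<sigma> h (so_mats (2 * n))
       (\<lambda>A. complex_structure_mat n * A * transpose_mat (complex_structure_mat n))"

definition cartan_number ::
  "('g::euclidean_space \<Rightarrow> 'g \<Rightarrow> 'g) \<Rightarrow> 'g set \<Rightarrow> 'g form \<Rightarrow> 'g form \<Rightarrow> complex" where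
  "cartan_number br \<tt> \<alpha> \<beta> =
     2 * killing_cplx br (sharp br \<tt> \<alpha>) (sharp br \<tt> \<beta>)
       / killing_cplx br (sharp br \<tt> \<beta>) (sharp br \<tt> \<beta>)"

text \<open>The Dynkin diagram on the set \<open>S\<close> of simple roots has only simple edges, namely those
  in \<open>E\<close>.\<close>

definition simply_laced_diagram ::
  "('g::euclidean_space \<Rightarrow> 'g \<Rightarrow> 'g) \<Rightarrow> 'g set \<Rightarrow> 'g form set \<Rightarrow> 'g form set set \<Rightarrow> bool" where
  "simply_laced_diagram br \<tt> S E \<longleftrightarrow>
     (\<forall>\<alpha>\<in>S. \<forall>\<beta>\<in>S. \<alpha> \<noteq> \<beta> \<longrightarrow> cartan_number br \<tt> \<alpha> \<beta> = (if {\<alpha>, \<beta>} \<in> E then - 1 else 0))"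

definition chain_edges :: "'a list \<Rightarrow> 'a set set" where
  "chain_edges l = {{l ! i, l ! Suc i} | i. Suc i < length l}"

text \<open>The diagram \<open>E\<^sub>6\<close>: a chain \<open>l\<close> of five nodes and a sixth node attached to its middle.\<close>

definition diagram_E6 ::
  "('g::euclidean_space \<Rightarrow> 'g \<Rightarrow> 'g) \<Rightarrow> 'g set \<Rightarrow> 'g form set \<Rightarrow> 'g form list \<Rightarrow> 'g form \<Rightarrow> bool"
where
  "diagram_E6 br \<tt> S l \<delta> \<longleftrightarrow> length l = 5 \<and> distinct (\<delta> # l) \<and> S = set (\<delta> # l) \<and>
     simply_laced_diagram br \<tt> S (chain_edges l \<union> {{l ! 2, \<delta>}})"

text \<open>\<open>E\<^sub>6 / (U(1) \<cdot> SO(10))\<close>: the Dynkin diagram of the factor is \<open>E\<^sub>6\<close>, and the fixed point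
  algebra of \<open>\<sigma>\<close> on it is the direct sum of a one-dimensional ideal \<open>z\<close> and a copy \<open>u\<close>
  of \<open>so(10)\<close>.\<close>

definition type_EIII ::
  "('g::euclidean_space \<Rightarrow> 'g \<Rightarrow> 'g) \<Rightarrow> ('g \<Rightarrow> 'g) \<Rightarrow> 'g set \<Rightarrow> 'g form set \<Rightarrow> 'g set \<Rightarrow> bool" where
  "type_EIII br \<sigma> \<tt> P h \<longleftrightarrow>
     (\<exists>l \<delta>. diagram_E6 br \<tt> (factor_simple_roots br \<tt> P h) l \<delta>) \<and>
     (\<exists>z u. subspace z \<and> subspace u \<and> dim z = 1 \<and> z \<inter> u = {0} \<and>
        {x\<in>h. \<sigma> x = x} = {x + y | x y. x \<in> z \<and> y \<in> u} \<and>
        (\<forall>x\<in>z. \<forall>y\<in>u. br x y = 0) \<and> matrix_model br id u (so_mats 10) id)"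

section \<open>The normalization of the involution\<close>

text \<open>
  On one irreducible factor \<open>h\<close> of one of the three exceptional kinds, \<open>k1\<close> being the index of the
  white root \<open>\<alpha>\<^sub>1\<close> of that factor and \<open>\<beta>\<close> the distinguished sum of black roots. The indices of
  \<open>white\<close> and \<open>black\<close> run over the simple roots of all of \<open>\<gg>\<close>, so the numbering used in the
  Satake diagram of a single factor is expressed through lists of such indices.
\<close>

definition special_normalization ::
  "('g::euclidean_space \<Rightarrow> 'g \<Rightarrow> 'g) \<Rightarrow> 'g set \<Rightarrow> 'g form set \<Rightarrow> nat \<Rightarrow> (nat \<Rightarrow> 'g form) \<Rightarrow>
    (nat \<Rightarrow> nat) \<Rightarrow> ('g form \<Rightarrow> 'g form \<Rightarrow> real) \<Rightarrow> ('g form \<Rightarrow> complex) \<Rightarrow> 'g set \<Rightarrow>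
    nat \<Rightarrow> 'g form \<Rightarrow> bool" where
  "special_normalization br \<tt> P r white \<pi> c sg h k1 \<beta> \<longleftrightarrow>
     sg (white (\<pi> k1)) = complex_of_real (c \<beta> (white k1) / c (white (\<pi> k1)) \<beta>) \<and>
     (\<forall>k\<in>{1..r}. white k \<in> factor_simple_roots br \<tt> P h \<and> k \<noteq> \<pi> k1 \<longrightarrow> sg (white k) = 1)"

text \<open>The chain \<open>\<alpha>\<^sub>q, \<dots>, \<alpha>\<^sub>1, \<beta>\<^sub>1, \<dots>, \<beta>\<^sub>s, \<alpha>\<^bsub>\<pi>(1)\<^esub>, \<dots>, \<alpha>\<^bsub>\<pi>(q)\<^esub>\<close>; \<open>ks\<close> and \<open>js\<close> list the
  indices of \<open>\<alpha>\<^sub>1, \<dots>, \<alpha>\<^sub>q\<close> and \<open>\<beta>\<^sub>1, \<dots>, \<beta>\<^sub>s\<close>.\<close>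

definition labelling_AIII ::
  "('g::euclidean_space \<Rightarrow> 'g \<Rightarrow> 'g) \<Rightarrow> 'g set \<Rightarrow> 'g form set \<Rightarrow> nat \<Rightarrow> nat \<Rightarrow>
    (nat \<Rightarrow> 'g form) \<Rightarrow> (nat \<Rightarrow> 'g form) \<Rightarrow> (nat \<Rightarrow> nat) \<Rightarrow> 'g set \<Rightarrow> nat \<Rightarrow>
    nat list \<Rightarrow> nat list \<Rightarrow> bool" where
  "labelling_AIII br \<tt> P r s white black \<pi> h q ks js \<longleftrightarrow>
     length ks = q \<and> set ks \<subseteq> {1..r} \<and> set js \<subseteq> {1..s} \<and>
     (let l = map white (rev ks) @ map black js @ map (\<lambda>k. white (\<pi> k)) ks
      in distinct l \<and> set l = factor_simple_roots br \<tt> P h \<and>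
         simply_laced_diagram br \<tt> (set l) (chain_edges l))"

text \<open>The diagram \<open>D\<^sub>n\<close>: a chain \<open>l\<close> of \<open>n - 2\<close> nodes ending in the black branch node, to which
  the two ends \<open>\<alpha>\<^sub>1\<close> and \<open>\<alpha>\<^bsub>\<pi>(1)\<^esub>\<close> of the fork are attached.\<close>

definition labelling_DIII ::
  "('g::euclidean_space \<Rightarrow> 'g \<Rightarrow> 'g) \<Rightarrow> 'g set \<Rightarrow> 'g form set \<Rightarrow> nat \<Rightarrow> nat \<Rightarrow>
    (nat \<Rightarrow> 'g form) \<Rightarrow> (nat \<Rightarrow> 'g form) \<Rightarrow> (nat \<Rightarrow> nat) \<Rightarrow> 'g set \<Rightarrow> nat \<Rightarrow>
    nat \<Rightarrow> nat \<Rightarrow> bool" where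
  "labelling_DIII br \<tt> P r s white black \<pi> h n k1 j \<longleftrightarrow>
     k1 \<in> {1..r} \<and> j \<in> {1..s} \<and>
     (\<exists>l. l \<noteq> [] \<and> length l + 2 = n \<and> last l = black j \<and>
        (let l' = l @ [white k1, white (\<pi> k1)]
         in distinct l' \<and> set l' = factor_simple_roots br \<tt> P h \<and>
            simply_laced_diagram br \<tt> (set l')
              (chain_edges l \<union> {{black j, white k1}, {black j, white (\<pi> k1)}})))"

definition labelling_EIII ::
  "('g::euclidean_space \<Rightarrow> 'g \<Rightarrow> 'g) \<Rightarrow> 'g set \<Rightarrow> 'g form set \<Rightarrow> nat \<Rightarrow> nat \<Rightarrow>
    (nat \<Rightarrow> 'g form) \<Rightarrow> (nat \<Rightarrow> 'g form) \<Rightarrow> (nat \<Rightarrow> nat) \<Rightarrow> 'g set \<Rightarrow>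
    nat \<Rightarrow> nat \<Rightarrow> nat \<Rightarrow> nat \<Rightarrow> nat \<Rightarrow> bool" where
  "labelling_EIII br \<tt> P r s white black \<pi> h k1 k2 j1 j2 j3 \<longleftrightarrow>
     {k1, k2} \<subseteq> {1..r} \<and> {j1, j2, j3} \<subseteq> {1..s} \<and>
     diagram_E6 br \<tt> (factor_simple_roots br \<tt> P h)
       [white k1, black j1, black j2, black j3, white (\<pi> k1)] (white k2)"

definition normalized ::
  "('g::euclidean_space \<Rightarrow> 'g \<Rightarrow> 'g) \<Rightarrow> ('g \<Rightarrow> 'g) \<Rightarrow> 'g set \<Rightarrow> 'g form set \<Rightarrow> nat \<Rightarrow> nat \<Rightarrow>
    (nat \<Rightarrow> 'g form) \<Rightarrow> (nat \<Rightarrow> 'g form) \<Rightarrow> (nat \<Rightarrow> nat) \<Rightarrow>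
    ('g form \<Rightarrow> 'g form \<Rightarrow> real) \<Rightarrow> ('g form \<Rightarrow> complex) \<Rightarrow> bool" where
  "normalized br \<sigma> \<tt> P r s white black \<pi> c sg \<longleftrightarrow>
     (\<forall>h. irreducible_factor br \<sigma> h \<longrightarrow>
        (\<forall>n q. type_AIII br \<sigma> h n q \<and> 2 * q + 1 < n \<longrightarrow>
           (\<exists>ks js. labelling_AIII br \<tt> P r s white black \<pi> h q ks js \<and>
              special_normalization br \<tt> P r white \<pi> c sg h (hd ks) (\<Sum>j\<in>set js. black j))) \<and>
        (\<forall>n. type_DIII br \<sigma> h n \<and> odd n \<longrightarrow>
           (\<exists>k1 j. labelling_DIII br \<tt> P r s white black \<pi> h n k1 j \<and>
              special_normalization br \<tt> P r white \<pi> c sg h k1 (black j))) \<and>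
        (type_EIII br \<sigma> \<tt> P h \<longrightarrow>
           (\<exists>k1 k2 j1 j2 j3. labelling_EIII br \<tt> P r s white black \<pi> h k1 k2 j1 j2 j3 \<and>
              special_normalization br \<tt> P r white \<pi> c sg h k1
                (black j1 + black j2 + black j3))) \<and>
        ((\<nexists>n q. type_AIII br \<sigma> h n q \<and> 2 * q + 1 < n) \<and>
         (\<nexists>n. type_DIII br \<sigma> h n \<and> odd n) \<and> \<not> type_EIII br \<sigma> \<tt> P h \<longrightarrow>
           (\<forall>k\<in>{1..r}. white k \<in> factor_simple_roots br \<tt> P h \<longrightarrow> sg (white k) = 1)))"

section \<open>The vectors $V_\alpha(z)$\<close>

definition V ::
  "('g::euclidean_space \<Rightarrow> 'g \<Rightarrow> 'g) \<Rightarrow> 'g set \<Rightarrow> ('g form \<Rightarrow> 'g cplx) \<Rightarrow> 'g form \<Rightarrow> complex \<Rightarrow>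
    'g cplx" where
  "V br \<tt> X \<alpha> z =
     (if \<alpha> \<in> roots br \<tt> then complex_of_real (1 / sqrt 2) *\<^sub>C (z *\<^sub>C X \<alpha> - cnj z *\<^sub>C X (- \<alpha>)) else 0)"

end

theory Submission
  imports Defs
begin

text \<open>
  One-dimensionality of the root spaces turns a real \<open>Y\<close> with \<open>ad(H)\<^sup>2 Y = \<alpha>(H)\<^sup>2 Y\<close> into some
  \<open>V\<^sub>\<alpha>(z)\<close>; the bracket and orthogonality relations are then computed on the \<open>X\<^sub>\<alpha>\<close>. The substance
  of the last claim is that \<open>s\<^sub>\<alpha>\<close> is real. By \<open>s\<^bsub>-\<alpha>\<^esub> = cnj s\<^sub>\<alpha>\<close> and
  \<open>c\<^bsub>\<zeta>,\<eta>\<^esub> s\<^bsub>\<zeta>+\<eta>\<^esub> = s\<^sub>\<zeta> s\<^sub>\<eta> c\<^bsub>\<sigma>(\<zeta>),\<sigma>(\<eta>)\<^esub>\<close>, induction on the height reduces this to simple roots.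
  A black root is fixed by \<open>\<sigma>\<close>, so \<open>s\<^sub>\<alpha>\<^sup>2 = 1\<close>. For a white root, a \<open>\<sigma>\<close>-invariant ideal of least
  dimension whose complexification contains \<open>X\<^sub>\<alpha>\<close> is an irreducible factor, to which the
  normalization applies.
\<close>

section \<open>Complexification\<close>

lemma fst_cscale [simp]: "fst (z *\<^sub>C v) = Re z *\<^sub>R fst v - Im z *\<^sub>R snd v"
  and snd_cscale [simp]: "snd (z *\<^sub>C v) = Re z *\<^sub>R snd v + Im z *\<^sub>R fst v"
  by (simp_all add: cscale_def)

interpretation cplx: vector_space "cscale :: complex \<Rightarrow> 'g::real_vector cplx \<Rightarrow> 'g cplx"
  by unfold_locales (auto simp: prod_eq_iff algebra_simps)

lemma emb_simps [simp]: "fst (emb x) = x" "snd (emb x) = 0"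
  by (simp_all add: emb_def)

lemma emb_zero [simp]: "emb 0 = 0"
  by (simp add: prod_eq_iff)

lemma conj_cplx_simps [simp]: "fst (conj_cplx v) = fst v" "snd (conj_cplx v) = - snd v"
  by (simp_all add: conj_cplx_def)

lemma conj_cplx_add: "conj_cplx (u + v) = conj_cplx u + conj_cplx v"
  and conj_cplx_minus: "conj_cplx (- u) = - conj_cplx u"
  and conj_cplx_cscale: "conj_cplx (z *\<^sub>C u) = cnj z *\<^sub>C conj_cplx u"
  and conj_cplx_emb: "conj_cplx (emb x) = emb x"
  and conj_cplx_conj [simp]: "conj_cplx (conj_cplx u) = u"
  and conj_cplx_eq_0 [simp]: "conj_cplx u = 0 \<longleftrightarrow> u = 0"
  by (auto simp: prod_eq_iff)

lemma cplx_split: "v = emb (fst v) + \<i> *\<^sub>C emb (snd v)"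
  by (simp add: prod_eq_iff)

lemma neg_eq_self_iff: "- x = x \<longleftrightarrow> x = (0::'a::real_vector)"
proof
  assume "- x = x"
  then have "2 *\<^sub>R x = 0"
    by (metis add.left_inverse scaleR_2)
  then show "x = 0" by simp
qed simp

text \<open>Used to recognise a vector of the complexification, such as
  \<open>VX \<alpha> z\<close>, as an element of the real Lie algebra.\<close>

lemma conj_fixed_imp_emb: "conj_cplx v = v \<Longrightarrow> v = emb (fst v)"
  by (simp add: prod_eq_iff neg_eq_self_iff)

section \<open>Invariance of the Killing form\<close>

text \<open>Expanding \<open>g b\<close> and \<open>f c\<close> in the orthonormal basis
  \<open>Basis\<close> turns both traces into the same double sum of products of matrix
  coefficients.\<close>

lemma trace_end_commute:
  fixes f g :: "'a::euclidean_space \<Rightarrow> 'a"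
  assumes "linear f" "linear g"
  shows "trace_end (\<lambda>x. f (g x)) = trace_end (\<lambda>x. g (f x))"
proof -
  have exp: "h y \<bullet> b = (\<Sum>c\<in>Basis. (y \<bullet> c) * (h c \<bullet> b))" if "linear h" for h :: "'a \<Rightarrow> 'a" and b y
  proof -
    have "h y = h (\<Sum>c\<in>Basis. (y \<bullet> c) *\<^sub>R c)"
      by (simp add: euclidean_representation)
    also have "\<dots> = (\<Sum>c\<in>Basis. (y \<bullet> c) *\<^sub>R h c)"
      using that by (simp add: linear_sum linear_scale)
    finally show ?thesis
      by (simp add: inner_sum_left)
  qed
  have "trace_end (\<lambda>x. f (g x)) = (\<Sum>b\<in>Basis. \<Sum>c\<in>Basis. (g b \<bullet> c) * (f c \<bullet> b))"
    unfolding trace_end_def by (intro sum.cong refl exp assms(1))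
  also have "\<dots> = (\<Sum>c\<in>Basis. \<Sum>b\<in>Basis. (f c \<bullet> b) * (g b \<bullet> c))"
    by (rule trans[OF sum.swap]) (intro sum.cong refl mult.commute)
  also have "\<dots> = trace_end (\<lambda>x. g (f x))"
    unfolding trace_end_def by (intro sum.cong refl exp[symmetric] assms(2))
  finally show ?thesis .
qed

locale compact_lie_algebra =
  fixes br :: "'g::euclidean_space \<Rightarrow> 'g \<Rightarrow> 'g"
  assumes lie_bracket: "lie_bracket br"
    and killing_neg: "x \<noteq> 0 \<Longrightarrow> killing br x x < 0"
begin

lemma bilinear_br: "bilinear br"
  using lie_bracket by (simp add: lie_bracket_def)

lemmas br_add_left = bilinear_ladd[OF bilinear_br]
  and br_add_right = bilinear_radd[OF bilinear_br]
  and br_scale_left = bilinear_lmul[OF bilinear_br]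
  and br_scale_right = bilinear_rmul[OF bilinear_br]
  and br_zero_left [simp] = bilinear_lzero[OF bilinear_br]
  and br_zero_right [simp] = bilinear_rzero[OF bilinear_br]
  and br_minus_left = bilinear_lneg[OF bilinear_br]
  and br_minus_right = bilinear_rneg[OF bilinear_br]
  and br_diff_left = bilinear_lsub[OF bilinear_br]
  and br_diff_right = bilinear_rsub[OF bilinear_br]

lemmas br_linear = br_add_left br_add_right br_scale_left br_scale_right br_minus_left br_minus_right
  br_diff_left br_diff_right

lemma br_self: "br x x = 0"
  using lie_bracket by (simp add: lie_bracket_def)

lemma br_skew: "br x y = - br y x"
proof -
  have "br (x + y) (x + y) = br x x + br y y + (br x y + br y x)"
    by (simp add: br_linear algebra_simps)
  then show ?thesis
    by (simp add: br_self eq_neg_iff_add_eq_0)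
qed

text \<open>The Jacobi identity in the form ad [x, y] = [ad x, ad y], suited to rewriting under a
  trace.\<close>

lemma br_jacobi: "br (br x y) z = br x (br y z) - br y (br x z)"
proof -
  have "br x (br y z) + br y (br z x) + br z (br x y) = 0"
    using lie_bracket by (simp add: lie_bracket_def)
  moreover have "br y (br z x) = - br y (br x z)"
    by (metis br_skew br_minus_right)
  moreover have "br z (br x y) = - br (br x y) z"
    by (rule br_skew)
  ultimately show ?thesis
    by (simp add: algebra_simps)
qed

lemma linear_br: "linear (br x)"
  using bilinear_br by (simp add: bilinear_def)

lemma killing_sym: "killing br x y = killing br y x"
  unfolding killing_def by (intro trace_end_commute linear_br)

lemma killing_add_right: "killing br x (y + z) = killing br x y + killing br x z"
  and killing_scale_right: "killing br x (r *\<^sub>R y) = r * killing br x y"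
  by (simp_all add: killing_def trace_end_def br_linear inner_add_left sum.distrib sum_distrib_left)

lemma killing_add_left: "killing br (x + y) z = killing br x z + killing br y z"
  and killing_scale_left: "killing br (r *\<^sub>R x) y = r * killing br x y"
  by (metis killing_sym killing_add_right, metis killing_sym killing_scale_right)

lemma killing_minus_left: "killing br (- x) y = - killing br x y"
  and killing_minus_right: "killing br x (- y) = - killing br x y"
  using killing_scale_left[of "-1" x y] killing_scale_right[of x "-1" y] by simp_all

lemma killing_diff_left: "killing br (x - y) z = killing br x z - killing br y z"
  and killing_diff_right: "killing br x (y - z) = killing br x y - killing br x z"
  by (simp_all only: diff_conv_add_uminus killing_add_left killing_add_right
      killing_minus_left killing_minus_right)

lemma killing_zero [simp]: "killing br 0 x = 0" "killing br x 0 = 0"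
  using killing_scale_left[of 0 x x] killing_scale_right[of x 0 x] by simp_all

lemmas killing_linear = killing_add_left killing_add_right killing_scale_left killing_scale_right
  killing_minus_left killing_minus_right killing_diff_left killing_diff_right

text \<open>By ad [x, y] = [ad x, ad y], each side is a difference of two traces of triple products.
  One of these is common to both sides, and the other two agree by cyclicity of the trace.\<close>

lemma killing_invariant: "killing br (br x y) z = killing br x (br y z)"
proof -
  have lin: "linear (\<lambda>w. br x (br z w))"
    using linear_compose[OF linear_br linear_br] by (simp add: o_def)
  have eq: "trace_end (\<lambda>w. br y (br x (br z w))) = trace_end (\<lambda>w. br x (br z (br y w)))"
    using trace_end_commute[OF linear_br lin] .
  have "killing br (br x y) z =
      trace_end (\<lambda>w. br x (br y (br z w))) - trace_end (\<lambda>w. br y (br x (br z w)))"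
    by (simp add: killing_def trace_end_def br_jacobi inner_diff_left sum_subtractf)
  also have "\<dots> = killing br x (br y z)"
    unfolding eq by (simp add: killing_def trace_end_def br_jacobi br_diff_right inner_diff_left sum_subtractf)
  finally show ?thesis .
qed

lemma killing_eq_0: "killing br x x = 0 \<longleftrightarrow> x = 0"
  using killing_neg[of x] by fastforce

text \<open>Here ad (\<sigma> x) = \<sigma> (ad x) \<sigma> because \<sigma> is its own inverse, and
  a trace does not change under conjugation.\<close>

lemma killing_automorphism:
  assumes "linear \<sigma>" and hom: "\<And>x y. \<sigma> (br x y) = br (\<sigma> x) (\<sigma> y)" and inv: "\<And>x. \<sigma> (\<sigma> x) = x"
  shows "killing br (\<sigma> x) (\<sigma> y) = killing br x y"
proof -
  have "br (\<sigma> x) (br (\<sigma> y) w) = \<sigma> (br x (br y (\<sigma> w)))" for w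
    by (simp add: hom inv)
  then have "killing br (\<sigma> x) (\<sigma> y) = trace_end (\<lambda>w. \<sigma> (br x (br y (\<sigma> w))))"
    by (simp add: killing_def)
  also have "\<dots> = trace_end (\<lambda>w. br x (br y (\<sigma> (\<sigma> w))))"
    by (rule trace_end_commute[OF assms(1)], intro linear_compose[unfolded o_def, OF _ linear_br] assms(1))
  finally show ?thesis
    by (simp add: inv killing_def)
qed

text \<open>Gram-Schmidt for the definite form \<open>killing br\<close>, by induction over a finite
  spanning set. The inner product of the type class has no relation to the bracket and cannot supply
  this projection.\<close>

lemma killing_projection:
  assumes "subspace S"
  obtains y where "y \<in> S" "\<And>s. s \<in> S \<Longrightarrow> killing br (x - y) s = 0"
proof -
  obtain B where B: "finite B" "span B = S"
    by (metis assms basis_exists finiteI_independent span_subspace)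
  have "\<forall>x. \<exists>y\<in>span B. \<forall>s\<in>span B. killing br (x - y) s = 0"
    using B(1)
  proof (induction B)
    case empty
    then show ?case by simp
  next
    case (insert b C)
    obtain p where p: "p \<in> span C" "\<forall>s\<in>span C. killing br (b - p) s = 0"
      using insert.IH by blast
    show ?case
    proof
      fix x
      obtain y where y: "y \<in> span C" "\<forall>s\<in>span C. killing br (x - y) s = 0"
        using insert.IH by blast
      \<comment> \<open>\<open>e\<close> is the part of \<open>b\<close> orthogonal to
        \<open>span C\<close>, so adding a multiple of \<open>e\<close> to \<open>y\<close> keeps
        the orthogonality already achieved.\<close>
      define e where "e = b - p"
      define k where "k = killing br (x - y) e / killing br e e"
      have C: "v \<in> span (insert b C)" if "v \<in> span C" for v
        using that span_mono[of C "insert b C"] by blast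
      have e: "e \<in> span (insert b C)"
        unfolding e_def by (intro span_diff C p(1) span_base) simp
      \<comment> \<open>If \<open>e = 0\<close>, division by zero makes \<open>k\<close> equal to 0
        and the equation still holds; \<open>b\<close> may thus lie in
        \<open>span C\<close>.\<close>
      have ke: "k * killing br e e = killing br (x - y) e"
        by (cases "e = 0") (simp_all add: k_def killing_eq_0)
      have "killing br (x - (y + k *\<^sub>R e)) s = 0" if s: "s \<in> span (insert b C)" for s
      proof -
        obtain m where "s - m *\<^sub>R b \<in> span C"
          using s unfolding span_breakdown_eq by blast
        then have q: "s - m *\<^sub>R e \<in> span C" (is "?q \<in> _")
          unfolding e_def using span_add[OF _ span_scale[OF p(1), of m]] by (force simp: algebra_simps)
        have "killing br (x - (y + k *\<^sub>R e)) (?q + m *\<^sub>R e)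
          = killing br (x - y) ?q - k * killing br e ?q + m * (killing br (x - y) e - k * killing br e e)"
          by (simp add: killing_linear algebra_simps)
        also have "\<dots> = 0"
          using y(2) p(2) q ke unfolding e_def by simp
        finally show ?thesis by simp
      qed
      moreover have "y + k *\<^sub>R e \<in> span (insert b C)"
        by (intro span_add span_scale e C y(1))
      ultimately show "\<exists>y\<in>span (insert b C). \<forall>s\<in>span (insert b C). killing br (x - y) s = 0"
        by blast
    qed
  qed
  then show thesis
    using that B(2) by blast
qed

section \<open>Bracket and Killing form on the complexification\<close>

abbreviation brC :: "'g cplx \<Rightarrow> 'g cplx \<Rightarrow> 'g cplx" where "brC \<equiv> br_cplx br"
abbreviation kC :: "'g cplx \<Rightarrow> 'g cplx \<Rightarrow> complex" where "kC \<equiv> killing_cplx br"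

lemma brC_add_left: "brC (u + v) w = brC u w + brC v w"
  and brC_add_right: "brC u (v + w) = brC u v + brC u w"
  and brC_diff_left: "brC (u - v) w = brC u w - brC v w"
  and brC_diff_right: "brC u (v - w) = brC u v - brC u w"
  and brC_minus_left: "brC (- u) w = - brC u w"
  and brC_minus_right: "brC u (- w) = - brC u w"
  and brC_scale_left: "brC (z *\<^sub>C u) w = z *\<^sub>C brC u w"
  and brC_scale_right: "brC u (z *\<^sub>C w) = z *\<^sub>C brC u w"
  by (simp_all add: br_cplx_def prod_eq_iff br_linear algebra_simps)

lemma brC_zero [simp]: "brC 0 u = 0" "brC u 0 = 0"
  by (simp_all add: br_cplx_def prod_eq_iff)

lemmas brC_linear = brC_add_left brC_add_right brC_diff_left brC_diff_right brC_minus_left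
  brC_minus_right brC_scale_left brC_scale_right

lemma brC_skew: "brC u v = - brC v u"
  by (simp add: br_cplx_def prod_eq_iff br_skew[of "fst v"] br_skew[of "snd v"])

lemma brC_self [simp]: "brC u u = 0"
  by (simp add: br_cplx_def prod_eq_iff br_self br_skew[of "fst u" "snd u"])

lemma brC_jacobi: "brC (brC u v) w = brC u (brC v w) - brC v (brC u w)"
  by (simp add: br_cplx_def prod_eq_iff br_linear br_jacobi algebra_simps)

lemma brC_emb: "brC (emb x) (emb y) = emb (br x y)"
  by (simp add: br_cplx_def emb_def)

lemma conj_brC: "conj_cplx (brC u v) = brC (conj_cplx u) (conj_cplx v)"
  by (simp add: br_cplx_def prod_eq_iff br_linear)

lemma kC_add_left: "kC (u + v) w = kC u w + kC v w"
  and kC_add_right: "kC u (v + w) = kC u v + kC u w"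
  and kC_diff_left: "kC (u - v) w = kC u w - kC v w"
  and kC_diff_right: "kC u (v - w) = kC u v - kC u w"
  and kC_minus_left: "kC (- u) w = - kC u w"
  and kC_minus_right: "kC u (- w) = - kC u w"
  and kC_scale_left: "kC (z *\<^sub>C u) w = z * kC u w"
  and kC_scale_right: "kC u (z *\<^sub>C w) = z * kC u w"
  by (simp_all add: killing_cplx_def complex_eq_iff killing_linear algebra_simps)

lemma kC_zero [simp]: "kC 0 u = 0" "kC u 0 = 0"
  by (simp_all add: killing_cplx_def complex_eq_iff)

lemmas kC_linear = kC_add_left kC_add_right kC_diff_left kC_diff_right kC_minus_left
  kC_minus_right kC_scale_left kC_scale_right

lemma kC_invariant: "kC (brC u v) w = kC u (brC v w)"
  by (simp add: br_cplx_def killing_cplx_def complex_eq_iff killing_linear killing_invariant algebra_simps)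

lemma kC_emb: "kC (emb x) (emb y) = of_real (killing br x y)"
  by (simp add: killing_cplx_def complex_eq_iff)

text \<open>The cross terms cancel by symmetry. Hence \<open>- kC u (conj_cplx u)\<close> is the
  square of a Hermitian norm on the complexification.\<close>

lemma kC_conj_self: "kC u (conj_cplx u) = of_real (killing br (fst u) (fst u) + killing br (snd u) (snd u))"
  by (simp add: killing_cplx_def complex_eq_iff killing_linear killing_sym)

lemma kC_conj_self_neg:
  assumes "u \<noteq> 0"
  shows "Re (kC u (conj_cplx u)) < 0" "Im (kC u (conj_cplx u)) = 0"
proof -
  have "killing br x x \<le> 0" for x
    using killing_neg[of x] by (cases "x = 0") auto
  moreover have "fst u \<noteq> 0 \<or> snd u \<noteq> 0"
    using assms by (simp add: prod_eq_iff)
  ultimately show "Re (kC u (conj_cplx u)) < 0"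
    using killing_neg[of "fst u"] killing_neg[of "snd u"] unfolding kC_conj_self
    by (smt (verit) Re_complex_of_real)
qed (simp add: kC_conj_self)

lemma kC_conj_self_eq_0: "kC u (conj_cplx u) = 0 \<longleftrightarrow> u = 0"
  using kC_conj_self_neg[of u] by fastforce

end

section \<open>Roots\<close>

lemma forms_addD: "\<alpha> \<in> forms \<tt> \<Longrightarrow> v \<in> \<tt> \<times> \<tt> \<Longrightarrow> w \<in> \<tt> \<times> \<tt> \<Longrightarrow> \<alpha> (v + w) = \<alpha> v + \<alpha> w"
  and forms_scaleD: "\<alpha> \<in> forms \<tt> \<Longrightarrow> v \<in> \<tt> \<times> \<tt> \<Longrightarrow> \<alpha> (z *\<^sub>C v) = z * \<alpha> v"
  and forms_outside: "\<alpha> \<in> forms \<tt> \<Longrightarrow> v \<notin> \<tt> \<times> \<tt> \<Longrightarrow> \<alpha> v = 0"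
  unfolding forms_def by blast+

lemma forms_emb:
  assumes "\<alpha> \<in> forms \<tt>" "subspace \<tt>"
  shows "v \<in> \<tt> \<times> \<tt> \<Longrightarrow> \<alpha> v = \<alpha> (emb (fst v)) + \<i> * \<alpha> (emb (snd v))"
proof -
  assume v: "v \<in> \<tt> \<times> \<tt>"
  then have t: "emb (fst v) \<in> \<tt> \<times> \<tt>" "emb (snd v) \<in> \<tt> \<times> \<tt>" "\<i> *\<^sub>C emb (snd v) \<in> \<tt> \<times> \<tt>"
    using subspace_0[OF assms(2)] by (auto simp: emb_def cscale_def)
  have "\<alpha> v = \<alpha> (emb (fst v) + \<i> *\<^sub>C emb (snd v))"
    using cplx_split by metis
  also have "\<dots> = \<alpha> (emb (fst v)) + \<i> * \<alpha> (emb (snd v))"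
    using forms_addD forms_scaleD assms(1) t by metis
  finally show ?thesis .
qed

text \<open>Complex linearity determines a form on \<open>\<tt> \<times> \<tt>\<close> by its values
  on \<open>\<tt>\<close>, and outside both functions vanish by convention.\<close>

lemma forms_eqI:
  assumes "\<alpha> \<in> forms \<tt>" "\<beta> \<in> forms \<tt>" "subspace \<tt>"
    and "\<And>H. H \<in> \<tt> \<Longrightarrow> \<alpha> (emb H) = \<beta> (emb H)"
  shows "\<alpha> = \<beta>"
proof
  fix v
  show "\<alpha> v = \<beta> v"
  proof (cases "v \<in> \<tt> \<times> \<tt>")
    case True
    then show ?thesis
      using forms_emb[OF assms(1,3) True] forms_emb[OF assms(2,3) True] assms(4) by (auto simp: mem_Times_iff)
  next
    case False
    then show ?thesis
      using forms_outside assms(1,2) by metis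
  qed
qed

lemma forms_zero: "0 \<in> forms \<tt>"
  by (simp add: forms_def)

lemma forms_uminus: "\<alpha> \<in> forms \<tt> \<Longrightarrow> - \<alpha> \<in> forms \<tt>"
  by (simp add: forms_def)

lemma forms_add: "\<alpha> \<in> forms \<tt> \<Longrightarrow> \<beta> \<in> forms \<tt> \<Longrightarrow> \<alpha> + \<beta> \<in> forms \<tt>"
  by (simp add: forms_def algebra_simps)

lemma forms_nonzero:
  assumes "\<alpha> \<in> forms \<tt>" "\<alpha> \<noteq> 0" "subspace \<tt>"
  obtains H where "H \<in> \<tt>" "\<alpha> (emb H) \<noteq> 0"
  using forms_eqI[OF assms(1) forms_zero assms(3)] assms(2) by fastforce

lemma uminus_form_neq:
  fixes \<alpha> :: "'g::euclidean_space form"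
  assumes "\<alpha> \<noteq> 0"
  shows "\<alpha> + \<alpha> \<noteq> 0" "- \<alpha> \<noteq> \<alpha>"
proof -
  obtain v where "\<alpha> v \<noteq> 0"
    using assms by (metis ext zero_fun_apply)
  then have "(\<alpha> + \<alpha>) v \<noteq> 0"
    by simp
  then show "\<alpha> + \<alpha> \<noteq> 0"
    by (metis zero_fun_apply)
  then show "- \<alpha> \<noteq> \<alpha>"
    by (metis neg_eq_iff_add_eq_0)
qed

section \<open>Cartan subalgebra and complex root spaces\<close>

locale compact_cartan = compact_lie_algebra br
  for br :: "'g::euclidean_space \<Rightarrow> 'g \<Rightarrow> 'g" +
  fixes \<tt> :: "'g set"
  assumes cartan: "cartan_subalgebra br \<tt>"
begin

abbreviation \<Delta> :: "'g form set" where "\<Delta> \<equiv> roots br \<tt>"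
abbreviation \<gg> :: "'g form \<Rightarrow> 'g cplx set" where "\<gg> \<equiv> root_space_cplx br \<tt>"

lemma subspace_cartan: "subspace \<tt>"
  using cartan by (simp add: maximal_abelian_in_def abelian_subspace_def)

lemma cartan_commute: "x \<in> \<tt> \<Longrightarrow> y \<in> \<tt> \<Longrightarrow> br x y = 0"
  using cartan by (simp add: maximal_abelian_in_def abelian_subspace_def)

lemma zero_cartan_cplx: "0 \<in> \<tt> \<times> \<tt>"
  using subspace_0[OF subspace_cartan] by (simp add: mem_Times_iff)

lemma brC_cartan: "H \<in> \<tt> \<Longrightarrow> K \<in> \<tt> \<Longrightarrow> brC (emb H) (emb K) = 0"
  by (simp add: brC_emb cartan_commute)

text \<open>The span of \<open>A\<close> and \<open>x\<close> is abelian, so maximality forces it to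
  be \<open>A\<close>. The ambient subspace \<open>U\<close> is kept general: it is the whole
  algebra for the Cartan subalgebra and the (-1)-eigenspace of \<sigma> for the flat.\<close>

lemma maximal_abelian_centralizer:
  assumes "maximal_abelian_in br U A" "subspace U" "x \<in> U" and comm: "\<And>H. H \<in> A \<Longrightarrow> br H x = 0"
  shows "x \<in> A"
proof -
  have A: "A \<subseteq> U" "subspace A" "\<And>x y. x \<in> A \<Longrightarrow> y \<in> A \<Longrightarrow> br x y = 0"
    using assms(1) by (auto simp: maximal_abelian_in_def abelian_subspace_def)
  have sp: "span A = A"
    using A(2) by (simp add: span_eq_iff)
  define W where "W = span (insert x A)"
  have "br v w = 0" if "v \<in> W" "w \<in> W" for v w
  proof -
    obtain a b where ab: "v - a *\<^sub>R x \<in> A" "w - b *\<^sub>R x \<in> A"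
      using \<open>v \<in> W\<close> \<open>w \<in> W\<close> by (auto simp: W_def span_breakdown_eq sp)
    have "br x H = 0" if "H \<in> A" for H
      using comm[OF that] br_skew[of x H] by simp
    then have "br ((v - a *\<^sub>R x) + a *\<^sub>R x) ((w - b *\<^sub>R x) + b *\<^sub>R x) = 0"
      using ab comm A(3) unfolding br_add_left br_add_right br_scale_left br_scale_right
      by (simp add: br_self)
    then show ?thesis by simp
  qed
  moreover have "W \<subseteq> U"
    unfolding W_def using assms(2,3) A(1) by (intro span_minimal) auto
  moreover have "A \<subseteq> W"
    unfolding W_def by (auto intro: span_base)
  ultimately have "W = A"
    using assms(1) unfolding maximal_abelian_in_def abelian_subspace_def by (auto simp: W_def)
  then show ?thesis
    unfolding W_def by (metis insertI1 span_base)
qed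

lemma centralizer_cartan: "(\<And>H. H \<in> \<tt> \<Longrightarrow> br H x = 0) \<Longrightarrow> x \<in> \<tt>"
  by (rule maximal_abelian_centralizer[OF cartan]) auto

lemma centralizer_cartan_cplx:
  assumes "\<And>H. H \<in> \<tt> \<Longrightarrow> brC (emb H) v = 0"
  shows "v \<in> \<tt> \<times> \<tt>"
  using assms centralizer_cartan[of "fst v"] centralizer_cartan[of "snd v"]
  by (simp add: br_cplx_def prod_eq_iff mem_Times_iff)

lemma cartan_cscale: "v \<in> \<tt> \<times> \<tt> \<Longrightarrow> z *\<^sub>C v \<in> \<tt> \<times> \<tt>"
  using subspace_cartan by (simp add: mem_Times_iff subspace_add subspace_diff subspace_scale)

lemma root_forms: "\<alpha> \<in> \<Delta> \<Longrightarrow> \<alpha> \<in> forms \<tt>" and root_neq_0: "\<alpha> \<in> \<Delta> \<Longrightarrow> \<alpha> \<noteq> 0"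
  by (auto simp: roots_def)

text \<open>By complex linearity in \<open>H\<close>, the eigenvalue equation needs testing on real
  \<open>H\<close> only.\<close>

lemma root_space_iff:
  assumes "\<alpha> \<in> forms \<tt>"
  shows "v \<in> \<gg> \<alpha> \<longleftrightarrow> (\<forall>H\<in>\<tt>. brC (emb H) v = \<alpha> (emb H) *\<^sub>C v)"
proof (intro iffI ballI)
  fix H
  assume "v \<in> \<gg> \<alpha>" "H \<in> \<tt>"
  then show "brC (emb H) v = \<alpha> (emb H) *\<^sub>C v"
    using subspace_0[OF subspace_cartan] by (auto simp: root_space_cplx_def emb_def)
next
  assume eig: "\<forall>H\<in>\<tt>. brC (emb H) v = \<alpha> (emb H) *\<^sub>C v"
  show "v \<in> \<gg> \<alpha>"
    unfolding root_space_cplx_def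
  proof (intro CollectI ballI)
    fix H
    assume H: "H \<in> \<tt> \<times> \<tt>"
    have "brC H v = brC (emb (fst H)) v + \<i> *\<^sub>C brC (emb (snd H)) v"
      by (metis brC_add_left brC_scale_left cplx_split)
    also have "\<dots> = \<alpha> H *\<^sub>C v"
      using eig H forms_emb[OF assms subspace_cartan H]
      by (auto simp: mem_Times_iff cplx.scale_left_distrib)
    finally show "brC H v = \<alpha> H *\<^sub>C v" .
  qed
qed

lemma root_spaceD: "\<alpha> \<in> \<Delta> \<Longrightarrow> v \<in> \<gg> \<alpha> \<Longrightarrow> H \<in> \<tt> \<Longrightarrow> brC (emb H) v = \<alpha> (emb H) *\<^sub>C v"
  using root_space_iff root_forms by blast

lemma rootI: "\<alpha> \<in> forms \<tt> \<Longrightarrow> \<alpha> \<noteq> 0 \<Longrightarrow> v \<in> \<gg> \<alpha> \<Longrightarrow> v \<noteq> 0 \<Longrightarrow> \<alpha> \<in> \<Delta>"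
  by (auto simp: roots_def)

lemma root_vector:
  assumes "\<alpha> \<in> \<Delta>"
  obtains v where "v \<in> \<gg> \<alpha>" "v \<noteq> 0"
proof -
  have "0 \<in> \<gg> \<alpha>"
    by (simp add: root_space_cplx_def)
  then show thesis
    using assms that by (auto simp: roots_def)
qed

text \<open>For real \<open>H\<close>, ad H is skew for the definite Hermitian form
  \<open>kC u (conj_cplx v)\<close>, so its eigenvalues are imaginary.\<close>

lemma root_imaginary:
  assumes "\<alpha> \<in> \<Delta>" "H \<in> \<tt>"
  shows "cnj (\<alpha> (emb H)) = - \<alpha> (emb H)"
proof -
  obtain v where v: "v \<in> \<gg> \<alpha>" "v \<noteq> 0"
    using root_vector[OF assms(1)] .
  let ?a = "\<alpha> (emb H)" and ?k = "kC v (conj_cplx v)"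
  have eig: "brC (emb H) v = ?a *\<^sub>C v"
    using root_spaceD assms v by blast
  then have eig': "brC (emb H) (conj_cplx v) = cnj ?a *\<^sub>C conj_cplx v"
    by (metis conj_brC conj_cplx_cscale conj_cplx_emb)
  have "?a * ?k = kC (brC (emb H) v) (conj_cplx v)"
    by (simp add: eig kC_scale_left)
  also have "\<dots> = - kC v (brC (emb H) (conj_cplx v))"
    by (simp add: brC_skew[of "emb H" v] kC_minus_left kC_invariant)
  also have "\<dots> = - cnj ?a * ?k"
    by (simp add: eig' kC_scale_right)
  finally show ?thesis
    using kC_conj_self_eq_0[of v] v(2) by (simp add: add_eq_0_iff) (metis mult_right_cancel mult_minus_left minus_equation_iff)
qed

text \<open>Conjugation turns the eigenvalue \<alpha>(H) into its complex conjugate, which is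
  -\<alpha>(H).\<close>

lemma conj_root_space: "\<alpha> \<in> \<Delta> \<Longrightarrow> v \<in> \<gg> \<alpha> \<Longrightarrow> conj_cplx v \<in> \<gg> (- \<alpha>)"
proof (subst root_space_iff)
  show "\<alpha> \<in> \<Delta> \<Longrightarrow> - \<alpha> \<in> forms \<tt>"
    using root_forms forms_uminus by blast
next
  assume *: "\<alpha> \<in> \<Delta>" "v \<in> \<gg> \<alpha>"
  have "brC (emb H) (conj_cplx v) = cnj (\<alpha> (emb H)) *\<^sub>C conj_cplx v" if "H \<in> \<tt>" for H
    using root_spaceD[OF * that] by (metis conj_brC conj_cplx_cscale conj_cplx_emb)
  then show "\<forall>H\<in>\<tt>. brC (emb H) (conj_cplx v) = (- \<alpha>) (emb H) *\<^sub>C conj_cplx v"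
    using root_imaginary[OF *(1)] by simp
qed

lemma root_uminus:
  assumes "\<alpha> \<in> \<Delta>"
  shows "- \<alpha> \<in> \<Delta>"
proof -
  obtain v where "v \<in> \<gg> \<alpha>" "v \<noteq> 0"
    using root_vector[OF assms] .
  then show ?thesis
    using rootI[of "- \<alpha>" "conj_cplx v"] conj_root_space[OF assms] forms_uminus[OF root_forms[OF assms]]
      root_neq_0[OF assms] by simp
qed

text \<open>Invariance gives (\<alpha> + \<beta>)(H) \<open>kC u v\<close> = 0; choose
  \<open>H\<close> with (\<alpha> + \<beta>)(H) nonzero.\<close>

lemma root_spaces_orthogonal:
  assumes "\<alpha> \<in> \<Delta>" "\<beta> \<in> \<Delta>" "\<alpha> + \<beta> \<noteq> 0" "u \<in> \<gg> \<alpha>" "v \<in> \<gg> \<beta>"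
  shows "kC u v = 0"
proof -
  obtain H where H: "H \<in> \<tt>" "(\<alpha> + \<beta>) (emb H) \<noteq> 0"
    using forms_nonzero[OF forms_add[OF root_forms root_forms] assms(3) subspace_cartan] assms by metis
  have "\<alpha> (emb H) * kC u v = kC (brC (emb H) u) v"
    using root_spaceD assms H by (simp add: kC_scale_left)
  also have "\<dots> = - kC u (brC (emb H) v)"
    by (simp add: brC_skew[of "emb H" u] kC_minus_left kC_invariant)
  also have "\<dots> = - \<beta> (emb H) * kC u v"
    using root_spaceD assms H by (simp add: kC_scale_right)
  finally have "(\<alpha> (emb H) + \<beta> (emb H)) * kC u v = 0"
    by (simp add: algebra_simps)
  then show ?thesis
    using H(2) by simp
qed

text \<open>Since ad H is a derivation, [u, v] has eigenvalue \<alpha>(H) - \<alpha>(H) = 0, and an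
  element centralizing \<open>\<tt>\<close> lies in its complexification. The pairing formula is
  invariance.\<close>

lemma root_bracket_cartan:
  assumes "\<alpha> \<in> \<Delta>" "u \<in> \<gg> \<alpha>" "v \<in> \<gg> (- \<alpha>)"
  shows "brC u v \<in> \<tt> \<times> \<tt>" and "H \<in> \<tt> \<Longrightarrow> kC (brC u v) (emb H) = \<alpha> (emb H) * kC u v"
proof -
  have eig: "brC (emb H) u = \<alpha> (emb H) *\<^sub>C u" "brC (emb H) v = - \<alpha> (emb H) *\<^sub>C v" if "H \<in> \<tt>" for H
    using root_spaceD[OF assms(1,2) that] root_spaceD[OF root_uminus[OF assms(1)] assms(3) that] by auto
  show "brC u v \<in> \<tt> \<times> \<tt>"
  proof (rule centralizer_cartan_cplx)
    fix H
    assume "H \<in> \<tt>"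
    have "brC (emb H) (brC u v) = brC (brC (emb H) u) v + brC u (brC (emb H) v)"
      by (simp add: brC_jacobi)
    then show "brC (emb H) (brC u v) = 0"
      by (simp add: eig[OF \<open>H \<in> \<tt>\<close>] brC_scale_left brC_scale_right brC_minus_right)
  qed
  show "kC (brC u v) (emb H) = \<alpha> (emb H) * kC u v" if "H \<in> \<tt>"
    using eig(2)[OF that] by (simp add: kC_invariant brC_skew[of v] kC_minus_right kC_scale_right)
qed

section \<open>The dual vectors of the roots\<close>

text \<open>The conjugate of the difference \<open>v - w\<close> is again a complex combination of
  elements of \<open>\<tt>\<close>, so the difference has Hermitian norm 0.\<close>

lemma cartan_dual_unique:
  assumes "v \<in> \<tt> \<times> \<tt>" "w \<in> \<tt> \<times> \<tt>" and eq: "\<And>H. H \<in> \<tt> \<Longrightarrow> kC v (emb H) = kC w (emb H)"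
  shows "v = w"
proof -
  let ?d = "v - w"
  have d: "fst ?d \<in> \<tt>" "snd ?d \<in> \<tt>"
    using assms(1,2) subspace_diff[OF subspace_cartan] by (auto simp: mem_Times_iff)
  then have "kC ?d (conj_cplx ?d) = 0"
    using cplx_split[of "conj_cplx ?d"] eq[OF d(1)] eq[OF subspace_neg[OF subspace_cartan d(2)]]
    by (metis (no_types, lifting) add.right_neutral conj_cplx_simps kC_add_right kC_diff_left
        kC_scale_right mult_zero_right right_minus_eq)
  then show ?thesis
    by (simp add: kC_conj_self_eq_0)
qed

text \<open>Justifies the definite description in \<open>sharp\<close>. For a root vector
  \<open>u\<close>, the multiple of [u, conj u] that represents \<alpha> is negated by conjugation,
  hence lies in i \<open>\<tt>\<close>.\<close>

lemma sharp_unique_existence: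
  assumes "\<alpha> \<in> \<Delta>"
  shows "\<exists>!v. v \<in> {0} \<times> \<tt> \<and> (\<forall>H\<in>\<tt>. kC v (emb H) = \<alpha> (emb H))"
proof -
  obtain u where u: "u \<in> \<gg> \<alpha>" "u \<noteq> 0"
    using root_vector[OF assms] .
  let ?k = "kC u (conj_cplx u)"
  have k: "?k \<noteq> 0" "cnj ?k = ?k"
    using u(2) by (simp_all add: kC_conj_self_eq_0) (simp add: kC_conj_self)
  define v where "v = (1 / ?k) *\<^sub>C brC u (conj_cplx u)"
  note b = root_bracket_cartan[OF assms u(1) conj_root_space[OF assms u(1)]]
  have "conj_cplx v = - v"
    unfolding v_def by (simp add: conj_cplx_cscale conj_brC k(2) brC_skew[of "conj_cplx u"])
  then have "fst v = 0"
    by (metis conj_cplx_simps(1) fst_uminus neg_eq_self_iff)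
  moreover have "v \<in> \<tt> \<times> \<tt>"
    unfolding v_def by (rule cartan_cscale[OF b(1)])
  moreover have "\<forall>H\<in>\<tt>. kC v (emb H) = \<alpha> (emb H)"
    using b(2) k(1) by (simp add: v_def kC_scale_left)
  ultimately show ?thesis
    using subspace_0[OF subspace_cartan]
    by (intro ex1I[of _ v]) (auto simp: mem_Times_iff intro!: cartan_dual_unique)
qed

lemma sharp_cartan: "\<alpha> \<in> \<Delta> \<Longrightarrow> sharp br \<tt> \<alpha> \<in> \<tt> \<times> \<tt>"
  and fst_sharp: "\<alpha> \<in> \<Delta> \<Longrightarrow> fst (sharp br \<tt> \<alpha>) = 0"
  and kC_sharp: "\<alpha> \<in> \<Delta> \<Longrightarrow> H \<in> \<tt> \<Longrightarrow> kC (sharp br \<tt> \<alpha>) (emb H) = \<alpha> (emb H)"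
  using theI'[OF sharp_unique_existence] subspace_0[OF subspace_cartan]
  unfolding sharp_def[symmetric] by (auto simp: mem_Times_iff)

lemma sharp_neq_0:
  assumes "\<alpha> \<in> \<Delta>"
  shows "sharp br \<tt> \<alpha> \<noteq> 0"
proof
  assume "sharp br \<tt> \<alpha> = 0"
  then have "\<alpha> (emb H) = 0" if "H \<in> \<tt>" for H
    using kC_sharp[OF assms that] by simp
  then show False
    using forms_nonzero root_forms root_neq_0 assms subspace_cartan by metis
qed

text \<open>With s the dual vector, \<alpha>(s) = \<open>kC s s\<close>; as s lies in i
  \<open>\<tt>\<close>, conjugation negates it and this is the square of its Hermitian norm.\<close>

lemma root_sharp_pos:
  assumes "\<alpha> \<in> \<Delta>"
  shows "Re (\<alpha> (sharp br \<tt> \<alpha>)) > 0"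
proof -
  let ?s = "sharp br \<tt> \<alpha>"
  have s: "snd ?s \<in> \<tt>" "?s = \<i> *\<^sub>C emb (snd ?s)"
    using sharp_cartan[OF assms] fst_sharp[OF assms] by (auto simp: mem_Times_iff prod_eq_iff)
  have "\<alpha> ?s = \<i> * \<alpha> (emb (snd ?s))"
    using forms_emb[OF root_forms[OF assms] subspace_cartan sharp_cartan[OF assms]]
      kC_sharp[OF assms subspace_0[OF subspace_cartan]] fst_sharp[OF assms]
    by (simp add: emb_def flip: zero_prod_def)
  also have "\<dots> = kC ?s ?s"
    using kC_sharp[OF assms s(1)] s(2) by (metis kC_scale_right)
  also have "\<dots> = - kC ?s (conj_cplx ?s)"
    by (simp add: killing_cplx_def fst_sharp[OF assms] killing_linear complex_eq_iff)
  finally show ?thesis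
    using kC_conj_self_neg[OF sharp_neq_0[OF assms]] by simp
qed

end

section \<open>The vectors $V_\alpha(z)$\<close>

locale compact_chevalley = compact_cartan br \<tt>
  for br :: "'g::euclidean_space \<Rightarrow> 'g \<Rightarrow> 'g" and \<tt> +
  fixes P :: "'g form set" and X :: "'g form \<Rightarrow> 'g cplx"
    and c :: "'g form \<Rightarrow> 'g form \<Rightarrow> real" and \<zeta> \<eta> :: "'g form \<Rightarrow> 'g form"
  assumes chevalley: "chevalley_basis br \<tt> P X c \<zeta> \<eta>"
begin

lemma X_root_space: "\<alpha> \<in> \<Delta> \<Longrightarrow> X \<alpha> \<in> \<gg> \<alpha>"
  and X_uminus: "\<alpha> \<in> \<Delta> \<Longrightarrow> X (- \<alpha>) = - conj_cplx (X \<alpha>)"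
  and brC_X_uminus: "\<alpha> \<in> \<Delta> \<Longrightarrow> brC (X \<alpha>) (X (- \<alpha>)) = sharp br \<tt> \<alpha>"
  and brC_X: "\<alpha> \<in> \<Delta> \<Longrightarrow> \<beta> \<in> \<Delta> \<Longrightarrow> \<alpha> + \<beta> \<in> \<Delta> \<Longrightarrow>
    brC (X \<alpha>) (X \<beta>) = complex_of_real (c \<alpha> \<beta>) *\<^sub>C X (\<alpha> + \<beta>)"
  and brC_X_nonroot: "\<alpha> \<in> \<Delta> \<Longrightarrow> \<beta> \<in> \<Delta> \<Longrightarrow> \<alpha> + \<beta> \<notin> \<Delta> \<Longrightarrow> \<alpha> + \<beta> \<noteq> 0 \<Longrightarrow> brC (X \<alpha>) (X \<beta>) = 0"
  and positive_split: "\<alpha> \<in> P - simple_roots P \<Longrightarrow>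
    \<zeta> \<alpha> \<in> P \<and> \<eta> \<alpha> \<in> P \<and> \<alpha> = \<zeta> \<alpha> + \<eta> \<alpha> \<and> c (\<zeta> \<alpha>) (\<eta> \<alpha>) > 0"
  using chevalley unfolding chevalley_basis_def by blast+

lemma conj_X: "\<alpha> \<in> \<Delta> \<Longrightarrow> conj_cplx (X \<alpha>) = - X (- \<alpha>)"
  by (simp add: X_uminus)

lemma X_neq_0: "\<alpha> \<in> \<Delta> \<Longrightarrow> X \<alpha> \<noteq> 0"
  using brC_X_uminus sharp_neq_0 by fastforce

text \<open>In general the bracket of vectors of \<open>\<gg> \<alpha>\<close> and
  \<open>\<gg> (- \<alpha>)\<close> pairs with \<open>H\<close> as \<alpha>(H) times their Killing
  product; the normalization of the Chevalley basis makes that product 1.\<close>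

lemma kC_X_uminus:
  assumes "\<alpha> \<in> \<Delta>"
  shows "kC (X \<alpha>) (X (- \<alpha>)) = 1"
proof -
  obtain H where H: "H \<in> \<tt>" "\<alpha> (emb H) \<noteq> 0"
    using forms_nonzero[OF root_forms root_neq_0 subspace_cartan] assms by metis
  have "\<alpha> (emb H) = \<alpha> (emb H) * kC (X \<alpha>) (X (- \<alpha>))"
    using root_bracket_cartan(2)[OF assms X_root_space[OF assms] X_root_space[OF root_uminus[OF assms]] H(1)]
      kC_sharp[OF assms H(1)] by (simp add: brC_X_uminus[OF assms])
  then show ?thesis
    using H(2) by simp
qed

lemma kC_X:
  assumes "\<alpha> \<in> \<Delta>" "\<beta> \<in> \<Delta>" "\<beta> \<noteq> - \<alpha>"
  shows "kC (X \<alpha>) (X \<beta>) = 0"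
  using assms root_spaces_orthogonal X_root_space by (metis add_eq_0_iff)

text \<open>If \<open>y\<close> in the root space of \<open>\<alpha>\<close> is orthogonal to \<open>X\<^sub>\<alpha>\<close>, then \<open>[y, X\<^sub>-\<^sub>\<alpha>] = 0\<close>, and
  the norm for the Hermitian form \<open>- \<kappa>(u, conj u)\<close> satisfies \<open>|[X\<^sub>\<alpha>, y]|\<^sup>2 = - \<alpha>(\<alpha>\<^sup>\<sharp>) |y|\<^sup>2\<close>, where
  \<open>\<alpha>(\<alpha>\<^sup>\<sharp>) > 0\<close>.\<close>

lemma root_space_one_dim:
  assumes "\<alpha> \<in> \<Delta>" "v \<in> \<gg> \<alpha>"
  obtains w where "v = w *\<^sub>C X \<alpha>"
proof -
  \<comment> \<open>The coefficient of \<open>v\<close> along \<open>X \<alpha>\<close>, because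
    \<open>kC (X \<alpha>) (X (- \<alpha>)) = 1\<close>.\<close>
  define w where "w = kC v (X (- \<alpha>))"
  define y where "y = v - w *\<^sub>C X \<alpha>"
  let ?a = "X \<alpha>" and ?b = "X (- \<alpha>)" and ?s = "sharp br \<tt> \<alpha>"
  have y: "y \<in> \<gg> \<alpha>"
    using assms(2) X_root_space[OF assms(1)] unfolding y_def root_space_cplx_def
    by (auto simp: brC_linear algebra_simps)
  have ky: "kC y ?b = 0"
    by (simp add: y_def kC_linear kC_X_uminus[OF assms(1)] w_def)
  note b = root_bracket_cartan[OF assms(1) y X_root_space[OF root_uminus[OF assms(1)]]]
  have yb: "brC y ?b = 0"
    using b ky zero_cartan_cplx by (intro cartan_dual_unique) simp_all
  have "brC (brC ?a y) ?b = - brC y ?s"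
    by (simp add: brC_jacobi yb brC_X_uminus[OF assms(1)])
  also have "\<dots> = \<alpha> ?s *\<^sub>C y"
    using y sharp_cartan[OF assms(1)] brC_skew[of y ?s] unfolding root_space_cplx_def by force
  finally have ayb: "brC (brC ?a y) ?b = \<alpha> ?s *\<^sub>C y" .
  have "kC (brC ?a y) (conj_cplx (brC ?a y)) = - kC (brC ?a y) (brC ?b (conj_cplx y))"
    by (simp add: conj_brC conj_X[OF assms(1)] brC_minus_left kC_minus_right)
  also have "\<dots> = - \<alpha> ?s * kC y (conj_cplx y)"
    by (simp add: ayb kC_scale_left flip: kC_invariant)
  finally have eq: "kC (brC ?a y) (conj_cplx (brC ?a y)) = - \<alpha> ?s * kC y (conj_cplx y)" .
  have "y = 0"
  proof (rule ccontr)
    assume "y \<noteq> 0"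
    then have "Re (kC (brC ?a y) (conj_cplx (brC ?a y))) > 0"
      using kC_conj_self_neg[of y] root_sharp_pos[OF assms(1)] by (simp add: eq mult_pos_neg)
    moreover have "Re (kC u (conj_cplx u)) \<le> 0" for u
      using kC_conj_self_neg[of u] by (cases "u = 0") auto
    ultimately show False
      by (meson not_less)
  qed
  then show thesis
    using that[of w] unfolding y_def by simp
qed

section \<open>The vectors \<open>VX \<alpha> z\<close> and the real root spaces\<close>

abbreviation VX :: "'g form \<Rightarrow> complex \<Rightarrow> 'g cplx" where "VX \<equiv> V br \<tt> X"

lemma V_root: "\<alpha> \<in> \<Delta> \<Longrightarrow>
    VX \<alpha> z = complex_of_real (1 / sqrt 2) *\<^sub>C (z *\<^sub>C X \<alpha> - cnj z *\<^sub>C X (- \<alpha>))"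
  by (simp add: V_def)

lemma conj_V: "conj_cplx (VX \<alpha> z) = VX \<alpha> z"
proof (cases "\<alpha> \<in> \<Delta>")
  case True
  then show ?thesis
    using root_uminus[OF True]
    by (simp add: V_root conj_cplx_cscale conj_cplx_add conj_cplx_minus conj_X diff_conv_add_uminus
        del: add_uminus_conv_diff)
next
  case False
  then show ?thesis by (simp add: V_def)
qed

text \<open>As \<alpha>(H) is imaginary, the conjugate of \<alpha>(H) z is -\<alpha>(H) times that
  of z, which matches the eigenvalue of ad H on \<open>X (- \<alpha>)\<close>.\<close>

lemma brC_cartan_V:
  assumes "\<alpha> \<in> \<Delta>" "H \<in> \<tt>"
  shows "brC (emb H) (VX \<alpha> z) = VX \<alpha> (\<alpha> (emb H) * z)"
  using root_spaceD[OF assms(1) X_root_space[OF assms(1)] assms(2)] root_imaginary[OF assms]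
    root_spaceD[OF root_uminus[OF assms(1)] X_root_space[OF root_uminus[OF assms(1)]] assms(2)]
  by (simp add: V_root[OF assms(1)] brC_linear mult.commute)

text \<open>\<open>VX \<alpha>\<close> is only real linear in \<open>z\<close>, since the second
  coefficient is conjugated.\<close>

lemma V_scale_real: "cnj r = r \<Longrightarrow> VX \<alpha> (r * z) = r *\<^sub>C VX \<alpha> z"
  by (simp add: V_def algebra_simps)

text \<open>Polarization of ad(L)^2 Y = \<alpha>(L)^2 Y at L = H + K; the mixed terms combine
  because ad H and ad K commute.\<close>

lemma root_space_polarized:
  assumes "\<alpha> \<in> \<Delta>" "Y \<in> root_space br \<tt> \<alpha>" "H \<in> \<tt>" "K \<in> \<tt>"
  shows "brC (emb H) (brC (emb K) (emb Y)) = (\<alpha> (emb H) * \<alpha> (emb K)) *\<^sub>C emb Y"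
proof -
  let ?y = "emb Y"
  have sq: "brC (emb L) (brC (emb L) ?y) = (\<alpha> (emb L))\<^sup>2 *\<^sub>C ?y" if "L \<in> \<tt>" for L
    using assms(2) that by (simp add: root_space_def brC_emb)
  have t: "emb L \<in> \<tt> \<times> \<tt>" if "L \<in> \<tt>" for L
    using that subspace_0[OF subspace_cartan] by (simp add: emb_def)
  have add: "emb (H + K) = emb H + emb K"
    by (simp add: prod_eq_iff)
  have \<alpha>: "\<alpha> (emb (H + K)) = \<alpha> (emb H) + \<alpha> (emb K)"
    unfolding add using forms_addD root_forms t assms by metis
  have comm: "brC (emb K) (brC (emb H) ?y) = brC (emb H) (brC (emb K) ?y)"
    using brC_cartan[OF assms(3,4)] brC_jacobi[of "emb H" "emb K" ?y] by simp
  have "brC (emb (H + K)) (brC (emb (H + K)) ?y) = brC (emb H) (brC (emb H) ?y)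
      + brC (emb K) (brC (emb K) ?y) + 2 *\<^sub>C brC (emb H) (brC (emb K) ?y)"
    using cplx.scale_left_distrib[of 1 1 "brC (emb H) (brC (emb K) ?y)"]
    by (simp add: add brC_linear comm)
  moreover have "(\<alpha> (emb (H + K)))\<^sup>2 *\<^sub>C ?y =
      (\<alpha> (emb H))\<^sup>2 *\<^sub>C ?y + (\<alpha> (emb K))\<^sup>2 *\<^sub>C ?y + 2 *\<^sub>C (\<alpha> (emb H) * \<alpha> (emb K)) *\<^sub>C ?y"
    by (simp add: \<alpha> power2_sum cplx.scale_left_distrib mult.assoc)
  ultimately have "2 *\<^sub>C brC (emb H) (brC (emb K) ?y) = 2 *\<^sub>C (\<alpha> (emb H) * \<alpha> (emb K)) *\<^sub>C ?y"
    using sq assms(3,4) subspace_add[OF subspace_cartan] by (metis add_left_cancel)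
  then show ?thesis
    by (metis cplx.scale_left_imp_eq zero_neq_numeral)
qed

text \<open>For \<open>H\<^sub>0\<close> in \<open>\<tt>\<close> with \<open>\<alpha>(H\<^sub>0) \<noteq> 0\<close>, the element \<open>Y + [H\<^sub>0, Y] / \<alpha>(H\<^sub>0)\<close> is twice the component
  of \<open>Y\<close> in the root space of \<open>\<alpha>\<close>, so that the root space decomposition is not needed.\<close>

lemma root_space_subset_V:
  assumes "\<alpha> \<in> \<Delta>" "Y \<in> root_space br \<tt> \<alpha>"
  obtains z where "emb Y = VX \<alpha> z"
proof -
  obtain H0 where H0: "H0 \<in> \<tt>" "\<alpha> (emb H0) \<noteq> 0"
    using forms_nonzero[OF root_forms root_neq_0 subspace_cartan] assms(1) by metis
  let ?y = "emb Y" and ?a = "\<alpha> (emb H0)" and ?d = "brC (emb H0) (emb Y)"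
  note pol = root_space_polarized[OF assms]
  have d: "brC (emb H) ?y = (\<alpha> (emb H) / ?a) *\<^sub>C ?d" if "H \<in> \<tt>" for H
  proof -
    \<comment> \<open>Replacing \<alpha>(H0)^2 Y by ad(H0)^2 Y and commuting ad H past one ad H0
      shows that every [H, Y] is a multiple of the single vector [H0, Y].\<close>
    have "(?a * ?a) *\<^sub>C brC (emb H) ?y = brC (emb H) (brC (emb H0) ?d)"
      using pol[OF H0(1) H0(1)] by (simp add: brC_scale_right)
    also have "\<dots> = brC (emb H0) (brC (emb H) ?d)"
      using brC_cartan[OF that H0(1)] brC_jacobi[of "emb H" "emb H0" ?d] by simp
    also have "\<dots> = (\<alpha> (emb H) * ?a) *\<^sub>C ?d"
      using pol[OF that H0(1)] by (simp add: brC_scale_right)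
    finally have "(1 / (?a * ?a)) *\<^sub>C (?a * ?a) *\<^sub>C brC (emb H) ?y
        = (1 / (?a * ?a)) *\<^sub>C (\<alpha> (emb H) * ?a) *\<^sub>C ?d" by simp
    then show ?thesis
      using H0(2) by simp
  qed
  define u where "u = (1/2) *\<^sub>C (?y + (1 / ?a) *\<^sub>C ?d)"
  have "brC (emb H) u = \<alpha> (emb H) *\<^sub>C u" if "H \<in> \<tt>" for H
    using d[OF that] pol[OF that H0(1)] H0(2)
    by (simp add: u_def brC_linear cplx.scale_right_distrib add.commute)
  then have "u \<in> \<gg> \<alpha>"
    using root_space_iff[OF root_forms[OF assms(1)]] by blast
  then obtain w where w: "u = w *\<^sub>C X \<alpha>"
    using root_space_one_dim[OF assms(1)] by blast
  have "conj_cplx u = (1/2) *\<^sub>C (?y - (1 / ?a) *\<^sub>C ?d)"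
    by (simp add: u_def conj_cplx_cscale conj_cplx_add conj_cplx_emb conj_brC
        root_imaginary[OF assms(1) H0(1)])
  then have "u + conj_cplx u = (1/2 + 1/2) *\<^sub>C ?y"
    unfolding u_def cplx.scale_left_distrib by (simp add: algebra_simps)
  then have "?y = w *\<^sub>C X \<alpha> - cnj w *\<^sub>C X (- \<alpha>)"
    using w by (simp add: conj_cplx_cscale conj_X[OF assms(1)])
  \<comment> \<open>The factor sqrt 2 compensates the 1 / sqrt 2 in \<open>V\<close>.\<close>
  also have "\<dots> = VX \<alpha> (complex_of_real (sqrt 2) * w)"
    by (simp add: V_root[OF assms(1)] cplx.scale_right_diff_distrib flip: of_real_mult mult.assoc)
  finally show thesis
    using that by blast
qed

text \<open>Applying ad H twice multiplies the parameter by \<alpha>(H)^2, which is real and can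
  therefore be taken out of \<open>VX\<close>.\<close>

lemma V_in_root_space:
  assumes "\<alpha> \<in> \<Delta>"
  shows "VX \<alpha> z \<in> emb ` root_space br \<tt> \<alpha>"
proof -
  let ?v = "VX \<alpha> z"
  have v: "?v = emb (fst ?v)"
    using conj_fixed_imp_emb conj_V by blast
  have "emb (br H (br H (fst ?v))) = (\<alpha> (emb H))\<^sup>2 *\<^sub>C emb (fst ?v)" if "H \<in> \<tt>" for H
  proof -
    have "emb (br H (br H (fst ?v))) = VX \<alpha> ((\<alpha> (emb H))\<^sup>2 * z)"
      using brC_cartan_V[OF assms that] v by (metis brC_emb mult.assoc power2_eq_square)
    also have "\<dots> = (\<alpha> (emb H))\<^sup>2 *\<^sub>C emb (fst ?v)"
      using root_imaginary[OF assms that] v by (subst V_scale_real) simp_all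
    finally show ?thesis .
  qed
  then show ?thesis
    using v unfolding root_space_def by blast
qed

lemma root_space_eq_V:
  assumes "\<alpha> \<in> \<Delta>"
  shows "emb ` root_space br \<tt> \<alpha> = {VX \<alpha> z | z. True}"
  using V_in_root_space[OF assms] root_space_subset_V[OF assms] by blast

section \<open>Brackets of the vectors \<open>VX \<alpha> z\<close>\<close>

text \<open>The two summands are conjugate to each other, so together they form a real vector, a
  multiple of \<open>VX (\<alpha> + \<beta>) u\<close>. If \<alpha> + \<beta> is not a root, both
  sides are 0, the right one by the default value of \<open>V\<close>.\<close>

lemma brC_X_conj_pair:
  assumes "\<alpha> \<in> \<Delta>" "\<beta> \<in> \<Delta>" "\<alpha> + \<beta> \<noteq> 0"
  shows "u *\<^sub>C brC (X \<alpha>) (X \<beta>) + cnj u *\<^sub>C brC (X (- \<alpha>)) (X (- \<beta>))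
    = complex_of_real (sqrt 2 * c \<alpha> \<beta>) *\<^sub>C VX (\<alpha> + \<beta>) u"
proof -
  have conj: "brC (X (- \<alpha>)) (X (- \<beta>)) = conj_cplx (brC (X \<alpha>) (X \<beta>))"
    using assms by (simp add: conj_brC X_uminus brC_minus_left brC_minus_right)
  show ?thesis
  proof (cases "\<alpha> + \<beta> \<in> \<Delta>")
    case True
    have "complex_of_real (sqrt 2) * complex_of_real (1 / sqrt 2) = 1"
      by (simp flip: of_real_mult)
    then have V: "complex_of_real (sqrt 2 * c \<alpha> \<beta>) *\<^sub>C VX (\<alpha> + \<beta>) u
        = complex_of_real (c \<alpha> \<beta>) *\<^sub>C (u *\<^sub>C X (\<alpha> + \<beta>) - cnj u *\<^sub>C X (- (\<alpha> + \<beta>)))"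
      unfolding V_root[OF True] by (simp add: field_simps)
    show ?thesis
      unfolding V conj brC_X[OF assms(1,2) True]
      by (simp add: conj_cplx_cscale conj_X[OF True] cplx.scale_right_diff_distrib mult.commute)
  next
    case False
    then show ?thesis
      using conj brC_X_nonroot[OF assms(1,2) False assms(3)] by (simp add: V_def conj_cplx_def prod_eq_iff)
  qed
qed

text \<open>The four brackets are grouped into two conjugate pairs, one for (\<alpha>, \<beta>) and
  one for (\<alpha>, -\<beta>), as \<open>brC_X_conj_pair\<close> expects.\<close>

lemma brC_V_expand:
  assumes "\<alpha> \<in> \<Delta>" "\<beta> \<in> \<Delta>"
  shows "brC (VX \<alpha> z) (VX \<beta> z') = (1/2) *\<^sub>C
    (((z * z') *\<^sub>C brC (X \<alpha>) (X \<beta>) + cnj (z * z') *\<^sub>C brC (X (- \<alpha>)) (X (- \<beta>)))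
     - ((z * cnj z') *\<^sub>C brC (X \<alpha>) (X (- \<beta>)) + cnj (z * cnj z') *\<^sub>C brC (X (- \<alpha>)) (X \<beta>)))"
proof -
  have "complex_of_real (1 / sqrt 2) * complex_of_real (1 / sqrt 2) = 1/2"
    by (simp flip: of_real_mult)
  then have "brC (VX \<alpha> z) (VX \<beta> z') =
      (1/2) *\<^sub>C brC (z *\<^sub>C X \<alpha> - cnj z *\<^sub>C X (- \<alpha>)) (z' *\<^sub>C X \<beta> - cnj z' *\<^sub>C X (- \<beta>))"
    unfolding V_root[OF assms(1)] V_root[OF assms(2)] brC_scale_left brC_scale_right cplx.scale_scale
    by simp
  also have "brC (z *\<^sub>C X \<alpha> - cnj z *\<^sub>C X (- \<alpha>)) (z' *\<^sub>C X \<beta> - cnj z' *\<^sub>C X (- \<beta>)) =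
    ((z * z') *\<^sub>C brC (X \<alpha>) (X \<beta>) + cnj (z * z') *\<^sub>C brC (X (- \<alpha>)) (X (- \<beta>)))
     - ((z * cnj z') *\<^sub>C brC (X \<alpha>) (X (- \<beta>)) + cnj (z * cnj z') *\<^sub>C brC (X (- \<alpha>)) (X \<beta>))"
    by (simp add: brC_linear cplx.scale_right_diff_distrib algebra_simps)
  finally show ?thesis .
qed

lemma brC_V:
  assumes "\<alpha> \<in> \<Delta>" "\<beta> \<in> \<Delta>" "\<beta> \<noteq> \<alpha>" "\<beta> \<noteq> - \<alpha>"
  shows "brC (VX \<alpha> z) (VX \<beta> z') = complex_of_real (1 / sqrt 2) *\<^sub>C
    (complex_of_real (c \<alpha> \<beta>) *\<^sub>C VX (\<alpha> + \<beta>) (z * z')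
     - complex_of_real (c \<alpha> (- \<beta>)) *\<^sub>C VX (\<alpha> - \<beta>) (z * cnj z'))"
proof -
  have ne: "\<alpha> + \<beta> \<noteq> 0" "\<alpha> + - \<beta> \<noteq> 0"
    using assms(3,4) by (metis add_eq_0_iff, metis add_eq_0_iff minus_minus)
  \<comment> \<open>The 1/2 is the product of the two normalizing factors, the sqrt 2 comes from
    \<open>brC_X_conj_pair\<close>.\<close>
  have "(1/2) * complex_of_real (sqrt 2) = complex_of_real (1 / sqrt 2)"
    by (simp add: real_div_sqrt field_simps flip: of_real_mult)
  then have half: "(1/2) *\<^sub>C complex_of_real (sqrt 2 * r) *\<^sub>C v = complex_of_real (1 / sqrt 2) *\<^sub>C complex_of_real r *\<^sub>C v"
    for r and v :: "'g cplx"
    by (metis cplx.scale_scale of_real_mult)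
  then show ?thesis
    unfolding brC_V_expand[OF assms(1,2)] brC_X_conj_pair[OF assms(1,2) ne(1)]
      brC_X_conj_pair[OF assms(1) root_uminus[OF assms(2)] ne(2), unfolded minus_minus]
      cplx.scale_right_diff_distrib half
    by simp
qed

text \<open>The first pair vanishes since [X, X] = 0. The second contributes the dual vector, with
  an imaginary coefficient as a difference of conjugate numbers.\<close>

lemma brC_V_self:
  assumes "\<alpha> \<in> \<Delta>"
  shows "brC (VX \<alpha> z) (VX \<alpha> z') = complex_of_real (Im (cnj z * z')) *\<^sub>C (\<i> *\<^sub>C sharp br \<tt> \<alpha>)"
proof -
  have "brC (X (- \<alpha>)) (X \<alpha>) = - sharp br \<tt> \<alpha>"
    using brC_X_uminus[OF assms] brC_skew by metis
  then have "brC (VX \<alpha> z) (VX \<alpha> z') = ((cnj (z * cnj z') - z * cnj z') / 2) *\<^sub>C sharp br \<tt> \<alpha>"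
    unfolding brC_V_expand[OF assms assms] using brC_X_uminus[OF assms]
    by (simp add: cplx.scale_left_diff_distrib diff_divide_distrib cplx.scale_right_diff_distrib)
  also have "(cnj (z * cnj z') - z * cnj z') / 2 = complex_of_real (Im (cnj z * z')) * \<i>"
    by (simp add: complex_eq_iff)
  finally show ?thesis by simp
qed

lemma brC_V_uminus:
  assumes "\<alpha> \<in> \<Delta>"
  shows "brC (VX \<alpha> z) (VX (- \<alpha>) z') = complex_of_real (Im (z * z')) *\<^sub>C (\<i> *\<^sub>C sharp br \<tt> \<alpha>)"
proof -
  have "brC (X (- \<alpha>)) (X \<alpha>) = - sharp br \<tt> \<alpha>"
    using brC_X_uminus[OF assms] brC_skew by metis
  then have "brC (VX \<alpha> z) (VX (- \<alpha>) z') = ((z * z' - cnj (z * z')) / 2) *\<^sub>C sharp br \<tt> \<alpha>"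
    unfolding brC_V_expand[OF assms root_uminus[OF assms]] using brC_X_uminus[OF assms]
    by (simp add: cplx.scale_left_diff_distrib diff_divide_distrib cplx.scale_right_diff_distrib)
  moreover have "(z * z' - cnj (z * z')) / 2 = complex_of_real (Im (z * z')) * \<i>"
    by (simp add: complex_eq_iff)
  ultimately show ?thesis
    by (simp only: cplx.scale_scale)
qed

section \<open>Orthogonality relations\<close>

text \<open>For \<alpha>(K) nonzero, Y is a multiple of ad(K)^2 Y, and invariance moves ad K onto
  \<open>H\<close>, where it vanishes.\<close>

lemma killing_cartan_root_space:
  assumes "\<alpha> \<in> \<Delta>" "H \<in> \<tt>" "Y \<in> root_space br \<tt> \<alpha>"
  shows "killing br H Y = 0"
proof -
  obtain K where K: "K \<in> \<tt>" "\<alpha> (emb K) \<noteq> 0"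
    using forms_nonzero[OF root_forms root_neq_0 subspace_cartan] assms(1) by metis
  have "(\<alpha> (emb K))\<^sup>2 * kC (emb H) (emb Y) = kC (emb H) (emb (br K (br K Y)))"
    using assms(3) K(1) by (simp add: root_space_def kC_scale_right)
  also have "\<dots> = 0"
    using cartan_commute[OF assms(2) K(1)] by (simp add: kC_emb flip: killing_invariant)
  finally show ?thesis
    using K(2) by (simp add: kC_emb)
qed

lemma kC_V_orthogonal:
  assumes "\<alpha> \<in> \<Delta>" "\<beta> \<in> \<Delta>" "\<alpha> \<noteq> \<beta>" "\<alpha> \<noteq> - \<beta>"
  shows "kC (VX \<alpha> z) (VX \<beta> z') = 0"
proof -
  have "\<beta> \<noteq> - \<alpha>" "- \<beta> \<noteq> - \<alpha>" "\<beta> \<noteq> - (- \<alpha>)" "- \<beta> \<noteq> - (- \<alpha>)"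
    using assms(3,4) by auto
  then show ?thesis
    using assms(1,2) root_uminus
    by (simp add: V_root kC_linear kC_X)
qed

lemma killing_root_spaces:
  assumes "\<alpha> \<in> \<Delta>" "\<beta> \<in> \<Delta>" "\<alpha> \<noteq> \<beta>" "\<alpha> \<noteq> - \<beta>" "Y \<in> root_space br \<tt> \<alpha>" "Z \<in> root_space br \<tt> \<beta>"
  shows "killing br Y Z = 0"
proof -
  obtain z z' where "emb Y = VX \<alpha> z" "emb Z = VX \<beta> z'"
    using root_space_subset_V[OF assms(1,5)] root_space_subset_V[OF assms(2,6)] by metis
  then show ?thesis
    using kC_V_orthogonal[OF assms(1-4)] by (metis kC_emb of_real_eq_0_iff)
qed

lemma kC_V:
  assumes "\<alpha> \<in> \<Delta>"
  shows "- kC (VX \<alpha> z) (VX \<alpha> z') = complex_of_real (Re (z * cnj z'))"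
proof -
  note m = root_uminus[OF assms]
  have k: "kC (X \<alpha>) (X \<alpha>) = 0" "kC (X (- \<alpha>)) (X (- \<alpha>)) = 0" "kC (X (- \<alpha>)) (X \<alpha>) = 1"
    using kC_X[OF assms assms] kC_X[OF m m] uminus_form_neq(2)[OF root_neq_0[OF assms]]
      kC_X_uminus[OF m] by auto
  have half: "complex_of_real (1 / sqrt 2) * (complex_of_real (1 / sqrt 2) * w) = w / 2" for w
    by (simp flip: of_real_mult mult.assoc)
  have "kC (VX \<alpha> z) (VX \<alpha> z') = (- (z * cnj z') - cnj z * z') / 2"
    unfolding V_root[OF assms] kC_scale_left kC_scale_right half
    by (simp add: kC_linear k kC_X_uminus[OF assms])
  then show ?thesis
    by (simp add: complex_eq_iff)
qed

end

section \<open>The involution and the numbers $s_\alpha$\<close>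

lemma lin_cplx_simps [simp]: "fst (lin_cplx f v) = f (fst v)" "snd (lin_cplx f v) = f (snd v)"
  by (simp_all add: lin_cplx_def)

text \<open>The numbers s_\<alpha> enter as a complex-valued function \<open>sg\<close>, constrained
  by \<open>lin_X\<close> and \<open>normalized\<close>; that they are real is derived in
  \<open>sg_real\<close>.\<close>

locale compact_symmetric_chevalley = compact_chevalley br \<tt> P X c \<zeta> \<eta>
  for br :: "'g::euclidean_space \<Rightarrow> 'g \<Rightarrow> 'g" and \<tt> P X c \<zeta> \<eta> +
  fixes \<sigma> :: "'g \<Rightarrow> 'g" and \<aa> :: "'g set" and r s :: nat and white black :: "nat \<Rightarrow> 'g form"
    and \<pi> :: "nat \<Rightarrow> nat" and n :: "nat \<Rightarrow> nat \<Rightarrow> nat" and sg :: "'g form \<Rightarrow> complex"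
  assumes symmetric: "compact_symmetric_lie_algebra br \<sigma>"
    and flat: "maximal_abelian_in br {x. \<sigma> x = - x} \<aa>" and flat_cartan: "\<aa> \<subseteq> \<tt>"
    and satake: "satake_description br \<sigma> \<tt> P r s white black \<pi> n"
    and lin_X: "\<And>\<gamma>. \<gamma> \<in> \<Delta> \<Longrightarrow> lin_cplx \<sigma> (X \<gamma>) = sg \<gamma> *\<^sub>C X (act \<sigma> \<gamma>)"
    and normalized: "normalized br \<sigma> \<tt> P r s white black \<pi> c sg"
begin

section \<open>Action of the involution on roots and root vectors\<close>

lemma linear_\<sigma>: "linear \<sigma>"
  and \<sigma>_br: "\<sigma> (br x y) = br (\<sigma> x) (\<sigma> y)"
  and \<sigma>_\<sigma> [simp]: "\<sigma> (\<sigma> x) = x"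
  using symmetric by (simp_all add: compact_symmetric_lie_algebra_def)

lemmas \<sigma>_linear = linear_add[OF linear_\<sigma>] linear_diff[OF linear_\<sigma>] linear_neg[OF linear_\<sigma>]
  linear_scale[OF linear_\<sigma>] linear_0[OF linear_\<sigma>]

abbreviation \<sigma>C :: "'g cplx \<Rightarrow> 'g cplx" where "\<sigma>C \<equiv> lin_cplx \<sigma>"

lemma \<sigma>C_diff: "\<sigma>C (u - v) = \<sigma>C u - \<sigma>C v"
  and \<sigma>C_minus: "\<sigma>C (- u) = - \<sigma>C u"
  and \<sigma>C_scale: "\<sigma>C (z *\<^sub>C u) = z *\<^sub>C \<sigma>C u"
  and \<sigma>C_add: "\<sigma>C (u + v) = \<sigma>C u + \<sigma>C v"
  and \<sigma>C_conj: "\<sigma>C (conj_cplx u) = conj_cplx (\<sigma>C u)"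
  and \<sigma>C_emb: "\<sigma>C (emb x) = emb (\<sigma> x)"
  and \<sigma>C_br: "\<sigma>C (brC u v) = brC (\<sigma>C u) (\<sigma>C v)"
  and \<sigma>C_\<sigma>C [simp]: "\<sigma>C (\<sigma>C u) = u"
  by (auto simp: prod_eq_iff \<sigma>_linear br_cplx_def \<sigma>_br)

lemma \<sigma>C_eq_0: "\<sigma>C u = 0 \<longleftrightarrow> u = 0"
  by (metis \<sigma>C_\<sigma>C \<sigma>C_diff diff_self)

lemma killing_\<sigma>: "killing br (\<sigma> x) (\<sigma> y) = killing br x y"
  by (rule killing_automorphism[OF linear_\<sigma> \<sigma>_br \<sigma>_\<sigma>])

lemma kC_\<sigma>C: "kC (\<sigma>C u) (\<sigma>C v) = kC u v"
  by (simp add: killing_cplx_def killing_\<sigma>)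

text \<open>The vector H - \<sigma>(H) lies in the (-1)-eigenspace and commutes with the flat
  \<open>\<aa>\<close>, hence belongs to \<open>\<aa>\<close> by maximality, and so to
  \<open>\<tt>\<close>.\<close>

lemma \<sigma>_cartan:
  assumes "H \<in> \<tt>"
  shows "\<sigma> H \<in> \<tt>"
proof -
  have "subspace {x. \<sigma> x = - x}"
    by (auto simp: subspace_def \<sigma>_linear)
  moreover have "br A (H - \<sigma> H) = 0" if "A \<in> \<aa>" for A
  proof -
    have A: "A \<in> \<tt>" "\<sigma> A = - A"
      using that flat flat_cartan by (auto simp: maximal_abelian_in_def)
    have "br A (\<sigma> H) = \<sigma> (br (\<sigma> A) H)"
      by (simp add: \<sigma>_br)
    then show ?thesis
      using cartan_commute[OF A(1) assms] by (simp add: A(2) br_diff_right br_minus_left \<sigma>_linear)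
  qed
  ultimately have "H - \<sigma> H \<in> \<aa>"
    by (intro maximal_abelian_centralizer[OF flat]) (simp_all add: \<sigma>_linear)
  then have "H - (H - \<sigma> H) \<in> \<tt>"
    using assms flat_cartan by (blast intro: subspace_diff[OF subspace_cartan])
  then show ?thesis by simp
qed

lemma act_eq: "act \<sigma> \<alpha> v = \<alpha> (\<sigma>C v)"
proof -
  have "inv_into UNIV \<sigma>C = \<sigma>C"
    by (rule inv_equality) simp_all
  then show ?thesis
    by (simp add: act_def)
qed

lemma act_uminus: "act \<sigma> (- \<alpha>) = - act \<sigma> \<alpha>"
  and act_add: "act \<sigma> (\<alpha> + \<beta>) = act \<sigma> \<alpha> + act \<sigma> \<beta>"
  by (simp_all add: fun_eq_iff act_eq)

lemma \<sigma>C_cartan_iff: "\<sigma>C v \<in> \<tt> \<times> \<tt> \<longleftrightarrow> v \<in> \<tt> \<times> \<tt>"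
  using \<sigma>_cartan[of "fst v"] \<sigma>_cartan[of "snd v"] \<sigma>_cartan[of "\<sigma> (fst v)"] \<sigma>_cartan[of "\<sigma> (snd v)"]
  by (auto simp: mem_Times_iff)

lemma act_forms:
  assumes "\<alpha> \<in> forms \<tt>"
  shows "act \<sigma> \<alpha> \<in> forms \<tt>"
proof -
  have "\<alpha> (\<sigma>C (v + w)) = \<alpha> (\<sigma>C v) + \<alpha> (\<sigma>C w)" "\<alpha> (\<sigma>C (z *\<^sub>C v)) = z * \<alpha> (\<sigma>C v)"
    if "v \<in> \<tt> \<times> \<tt>" "w \<in> \<tt> \<times> \<tt>" for v w z
    unfolding \<sigma>C_add \<sigma>C_scale
    using that forms_addD[OF assms] forms_scaleD[OF assms] by (simp_all only: \<sigma>C_cartan_iff)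
  moreover have "\<alpha> (\<sigma>C v) = 0" if "v \<notin> \<tt> \<times> \<tt>" for v
    using forms_outside[OF assms] that \<sigma>C_cartan_iff by blast
  ultimately show ?thesis
    unfolding forms_def act_eq by blast
qed

text \<open>The image of \<open>X \<alpha>\<close> under \<sigma> is a root vector for
  \<open>act \<sigma> \<alpha>\<close>.\<close>

lemma act_root:
  assumes "\<alpha> \<in> \<Delta>"
  shows "act \<sigma> \<alpha> \<in> \<Delta>"
proof (rule rootI)
  show f: "act \<sigma> \<alpha> \<in> forms \<tt>"
    using act_forms root_forms assms by blast
  show "act \<sigma> \<alpha> \<noteq> 0"
  proof
    assume "act \<sigma> \<alpha> = 0"
    then have "\<alpha> v = 0" for v
      using act_eq[of \<alpha> "\<sigma>C v"] by simp
    then show False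
      using root_neq_0[OF assms] by (metis ext zero_fun_apply)
  qed
  show "\<sigma>C (X \<alpha>) \<noteq> 0"
    using X_neq_0[OF assms] by (simp add: \<sigma>C_eq_0)
  have "brC (emb H) (\<sigma>C (X \<alpha>)) = act \<sigma> \<alpha> (emb H) *\<^sub>C \<sigma>C (X \<alpha>)" if "H \<in> \<tt>" for H
  proof -
    have "brC (emb H) (\<sigma>C (X \<alpha>)) = \<sigma>C (brC (emb (\<sigma> H)) (X \<alpha>))"
      by (simp add: \<sigma>C_br \<sigma>C_emb)
    also have "\<dots> = act \<sigma> \<alpha> (emb H) *\<^sub>C \<sigma>C (X \<alpha>)"
      using root_spaceD[OF assms X_root_space[OF assms] \<sigma>_cartan[OF that]]
      by (simp add: \<sigma>C_scale act_eq \<sigma>C_emb)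
    finally show ?thesis .
  qed
  then show "\<sigma>C (X \<alpha>) \<in> \<gg> (act \<sigma> \<alpha>)"
    using root_space_iff[OF f] by blast
qed

lemma scale_X_cancel: "\<alpha> \<in> \<Delta> \<Longrightarrow> z *\<^sub>C X \<alpha> = w *\<^sub>C X \<alpha> \<Longrightarrow> z = w"
  using X_neq_0 cplx.scale_right_imp_eq by blast

text \<open>Apply \<sigma>, which commutes with conjugation, to
  \<open>X (- \<alpha>) = - conj_cplx (X \<alpha>)\<close> and compare coefficients.\<close>

lemma sg_uminus:
  assumes "\<alpha> \<in> \<Delta>"
  shows "sg (- \<alpha>) = cnj (sg \<alpha>)"
proof (rule scale_X_cancel[OF root_uminus[OF act_root[OF assms]]])
  have "sg (- \<alpha>) *\<^sub>C X (- act \<sigma> \<alpha>) = \<sigma>C (X (- \<alpha>))"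
    using lin_X[OF root_uminus[OF assms]] by (simp add: act_uminus)
  also have "\<dots> = - conj_cplx (sg \<alpha> *\<^sub>C X (act \<sigma> \<alpha>))"
    by (simp add: X_uminus[OF assms] \<sigma>C_minus \<sigma>C_conj lin_X[OF assms])
  also have "\<dots> = cnj (sg \<alpha>) *\<^sub>C X (- act \<sigma> \<alpha>)"
    by (simp add: conj_cplx_cscale X_uminus[OF act_root[OF assms]])
  finally show "sg (- \<alpha>) *\<^sub>C X (- act \<sigma> \<alpha>) = cnj (sg \<alpha>) *\<^sub>C X (- act \<sigma> \<alpha>)" .
qed

lemma sg_add:
  assumes "\<alpha> \<in> \<Delta>" "\<beta> \<in> \<Delta>" "\<alpha> + \<beta> \<in> \<Delta>"
  shows "complex_of_real (c \<alpha> \<beta>) * sg (\<alpha> + \<beta>) =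
    sg \<alpha> * sg \<beta> * complex_of_real (c (act \<sigma> \<alpha>) (act \<sigma> \<beta>))"
proof (rule scale_X_cancel[OF act_root[OF assms(3)]])
  have "(complex_of_real (c \<alpha> \<beta>) * sg (\<alpha> + \<beta>)) *\<^sub>C X (act \<sigma> (\<alpha> + \<beta>)) = \<sigma>C (brC (X \<alpha>) (X \<beta>))"
    by (simp add: brC_X[OF assms] \<sigma>C_scale lin_X[OF assms(3)])
  also have "\<dots> = (sg \<alpha> * sg \<beta>) *\<^sub>C brC (X (act \<sigma> \<alpha>)) (X (act \<sigma> \<beta>))"
    by (simp add: \<sigma>C_br lin_X assms(1,2) brC_scale_left brC_scale_right)
  also have "brC (X (act \<sigma> \<alpha>)) (X (act \<sigma> \<beta>)) =
      complex_of_real (c (act \<sigma> \<alpha>) (act \<sigma> \<beta>)) *\<^sub>C X (act \<sigma> (\<alpha> + \<beta>))"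
    using brC_X[OF act_root[OF assms(1)] act_root[OF assms(2)]] act_root[OF assms(3)]
    by (simp add: act_add)
  finally show "(complex_of_real (c \<alpha> \<beta>) * sg (\<alpha> + \<beta>)) *\<^sub>C X (act \<sigma> (\<alpha> + \<beta>)) =
      (sg \<alpha> * sg \<beta> * complex_of_real (c (act \<sigma> \<alpha>) (act \<sigma> \<beta>))) *\<^sub>C X (act \<sigma> (\<alpha> + \<beta>))"
    by (simp only: cplx.scale_scale)
qed

text \<open>Invariance of the Killing form transfers the fixed dual vector to the root itself. Then
  \<open>X \<alpha>\<close> is an eigenvector of an involution, with eigenvalue 1 or -1.\<close>

lemma sg_fixed:
  assumes "\<alpha> \<in> \<Delta>" and fixed: "\<sigma>C (sharp br \<tt> \<alpha>) = sharp br \<tt> \<alpha>"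
  shows "sg \<alpha> \<in> \<real>"
proof -
  have "act \<sigma> \<alpha> = \<alpha>"
  proof (rule forms_eqI[OF act_forms[OF root_forms[OF assms(1)]] root_forms[OF assms(1)] subspace_cartan])
    fix H
    assume "H \<in> \<tt>"
    then have "act \<sigma> \<alpha> (emb H) = kC (sharp br \<tt> \<alpha>) (\<sigma>C (emb H))"
      using kC_sharp[OF assms(1) \<sigma>_cartan] by (simp add: act_eq \<sigma>C_emb)
    also have "\<dots> = kC (sharp br \<tt> \<alpha>) (emb H)"
      by (subst fixed[symmetric]) (rule kC_\<sigma>C)
    finally show "act \<sigma> \<alpha> (emb H) = \<alpha> (emb H)"
      using kC_sharp[OF assms(1) \<open>H \<in> \<tt>\<close>] by simp
  qed
  then have eig: "\<sigma>C (X \<alpha>) = sg \<alpha> *\<^sub>C X \<alpha>"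
    using lin_X[OF assms(1)] by simp
  then have "1 *\<^sub>C X \<alpha> = (sg \<alpha> * sg \<alpha>) *\<^sub>C X \<alpha>"
    by (metis \<sigma>C_\<sigma>C \<sigma>C_scale cplx.scale_one cplx.scale_scale)
  then have "1 = sg \<alpha> * sg \<alpha>"
    using scale_X_cancel[OF assms(1)] by blast
  then have "sg \<alpha> = 1 \<or> sg \<alpha> = - 1"
    by (metis power2_eq_1_iff power2_eq_square)
  then show ?thesis
    by (elim disjE) simp_all
qed

section \<open>Every root space lies in an irreducible factor\<close>

lemma invariant_ideal_cplx:
  assumes "invariant_ideal br \<sigma> h" "v \<in> h \<times> h"
  shows "z *\<^sub>C v \<in> h \<times> h" "brC (emb H) v \<in> h \<times> h"
  using assms
  by (auto simp: invariant_ideal_def mem_Times_iff br_cplx_def subspace_add subspace_diff subspace_scale)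

text \<open>Let \<open>h\<close> have least dimension among the invariant ideals containing
  \<open>X \<alpha>\<close> after complexification. An invariant ideal \<open>h'\<close> inside
  \<open>h\<close> splits off with its orthogonal complement \<open>N\<close>. The component of
  \<open>X \<alpha>\<close> in \<open>h'\<close> is a multiple of \<open>X \<alpha>\<close>, so
  \<open>X \<alpha>\<close> lies in one of the two summands, which must then be all of
  \<open>h\<close>.\<close>

lemma root_in_irreducible_factor:
  assumes "\<alpha> \<in> \<Delta>"
  obtains h where "irreducible_factor br \<sigma> h" "\<gg> \<alpha> \<subseteq> h \<times> h"
proof -
  define Q where "Q h \<longleftrightarrow> invariant_ideal br \<sigma> h \<and> X \<alpha> \<in> h \<times> h" for h
  have "Q UNIV"
    by (simp add: Q_def invariant_ideal_def)
  then obtain h where h: "Q h" and min: "\<And>h'. Q h' \<Longrightarrow> dim h \<le> dim h'"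
    using ex_has_least_nat[of Q UNIV dim] by blast
  have hI: "invariant_ideal br \<sigma> h" and hX: "X \<alpha> \<in> h \<times> h"
    using h by (simp_all add: Q_def)
  have min_eq: "h' = h" if "Q h'" "h' \<subseteq> h" for h'
    using that h min[OF that(1)] by (intro subspace_dim_equal) (auto simp: Q_def invariant_ideal_def)
  have "h' = {0} \<or> h' = h" if h'I: "invariant_ideal br \<sigma> h'" and "h' \<subseteq> h" for h'
  proof -
    have sub': "subspace h'" and sub: "subspace h"
      using h'I hI by (simp_all add: invariant_ideal_def)
    define N where "N = {x\<in>h. \<forall>t\<in>h'. killing br x t = 0}"
    have NI: "invariant_ideal br \<sigma> N"
      unfolding invariant_ideal_def
    proof (intro conjI allI ballI subsetI)
      show "subspace N"
        using sub by (auto simp: N_def subspace_def killing_linear)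
      show "br x y \<in> N" if "y \<in> N" for x y
      proof -
        have "killing br (br x y) t = - killing br y (br x t)" for t
          by (simp add: br_skew[of x y] killing_minus_left killing_invariant)
        then show ?thesis
          using that h'I hI by (auto simp: N_def invariant_ideal_def)
      qed
      show "x \<in> N" if x: "x \<in> \<sigma> ` N" for x
      proof -
        obtain y where y: "y \<in> N" "x = \<sigma> y"
          using x by blast
        have "killing br (\<sigma> y) t = 0" if "t \<in> h'" for t
          using y(1) that h'I killing_\<sigma>[of y "\<sigma> t"] by (auto simp: N_def invariant_ideal_def)
        then show ?thesis
          using y hI by (auto simp: N_def invariant_ideal_def)
      qed
    qed
    have triv: "x = 0" if "x \<in> h'" "x \<in> N" for x
      using that killing_eq_0[of x] by (simp add: N_def)
    have split: "\<exists>y\<in>h'. x - y \<in> N" if x: "x \<in> h" for x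
    proof -
      obtain y where "y \<in> h'" "\<And>t. t \<in> h' \<Longrightarrow> killing br (x - y) t = 0"
        using killing_projection[OF sub', of x] by blast
      then show ?thesis
        using x \<open>h' \<subseteq> h\<close> subspace_diff[OF sub] by (auto simp: N_def intro!: bexI[of _ y])
    qed
    obtain y1 y2 where y12: "y1 \<in> h'" "fst (X \<alpha>) - y1 \<in> N" "y2 \<in> h'" "snd (X \<alpha>) - y2 \<in> N"
      using split[of "fst (X \<alpha>)"] split[of "snd (X \<alpha>)"] hX by (auto simp: mem_Times_iff)
    define y where "y = (y1, y2)"
    have y: "y \<in> h' \<times> h'" "X \<alpha> - y \<in> N \<times> N"
      using y12 by (auto simp: y_def mem_Times_iff)
    have "brC (emb H) y = \<alpha> (emb H) *\<^sub>C y" if "H \<in> \<tt>" for H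
    proof -
      let ?d = "\<lambda>v. brC (emb H) v - \<alpha> (emb H) *\<^sub>C v"
      have in_I: "?d v \<in> I \<times> I" if "invariant_ideal br \<sigma> I" "v \<in> I \<times> I" for I v
        using invariant_ideal_cplx[OF that] that(1)
        by (auto simp: mem_Times_iff invariant_ideal_def subspace_diff simp del: fst_cscale snd_cscale)
      \<comment> \<open>The operator ad H - \<alpha>(H) kills \<open>X \<alpha>\<close> and
        preserves both summands, so its value at \<open>y\<close> lies in their intersection, which
        is trivial.\<close>
      have "?d y = - ?d (X \<alpha> - y)"
        using root_spaceD[OF assms X_root_space[OF assms] \<open>H \<in> \<tt>\<close>]
        by (simp add: brC_diff_right cplx.scale_right_diff_distrib)
      moreover have "- ?d (X \<alpha> - y) \<in> N \<times> N"
        using in_I[OF NI y(2)] NI unfolding invariant_ideal_def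
        by (intro subspace_neg subspace_Times) auto
      ultimately have "?d y \<in> N \<times> N"
        by simp
      then have "?d y = 0"
        using in_I[OF h'I y(1)] triv[of "fst (?d y)"] triv[of "snd (?d y)"]
        unfolding mem_Times_iff prod_eq_iff[of _ 0] by simp
      then show ?thesis by simp
    qed
    then have "y \<in> \<gg> \<alpha>"
      using root_space_iff[OF root_forms[OF assms]] by blast
    then obtain w where w: "y = w *\<^sub>C X \<alpha>"
      using root_space_one_dim[OF assms] by blast
    show ?thesis
    proof (cases "w = 0")
      case True
      then have "Q N"
        using y(2) w NI by (simp add: Q_def)
      then have "N = h"
        by (rule min_eq) (auto simp: N_def)
      then have "h' = {0}"
        using triv \<open>h' \<subseteq> h\<close> subspace_0[OF sub'] by blast
      then show ?thesis ..
    next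
      case False
      then have "X \<alpha> = (1 / w) *\<^sub>C y"
        using w by simp
      then have "Q h'"
        using invariant_ideal_cplx(1)[OF h'I y(1)] h'I by (simp add: Q_def)
      then show ?thesis
        using min_eq \<open>h' \<subseteq> h\<close> by blast
    qed
  qed
  moreover have "h \<noteq> {0}"
    using hX X_neq_0[OF assms] by (auto simp: mem_Times_iff prod_eq_iff)
  ultimately have "irreducible_factor br \<sigma> h"
    using hI by (simp add: irreducible_factor_def)
  moreover have "\<gg> \<alpha> \<subseteq> h \<times> h"
    using root_space_one_dim[OF assms] invariant_ideal_cplx(1)[OF hI hX] by (metis subsetI)
  ultimately show thesis
    by (rule that)
qed

section \<open>Reality of the numbers s_\<alpha>\<close>

text \<open>The one exceptional value is a quotient of real structure constants and the others are
  1, whatever \<open>k1\<close> and \<open>\<beta>\<close> are. The three exceptional types can thus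
  be treated alike.\<close>

lemma special_normalization_real:
  assumes "special_normalization br \<tt> P r white \<pi> c sg h k1 \<beta>"
    and "k \<in> {1..r}" "white k \<in> factor_simple_roots br \<tt> P h"
  shows "sg (white k) \<in> \<real>"
  using assms by (cases "k = \<pi> k1") (auto simp: special_normalization_def)

lemma sg_white:
  assumes k: "k \<in> {1..r}" and root: "white k \<in> \<Delta>"
  shows "sg (white k) \<in> \<real>"
proof -
  obtain h where h: "irreducible_factor br \<sigma> h" "\<gg> (white k) \<subseteq> h \<times> h"
    using root_in_irreducible_factor[OF root] .
  have "white k \<in> simple_roots P"
    using satake k by (auto simp: satake_description_def)
  then have f: "white k \<in> factor_simple_roots br \<tt> P h"
    using h(2) by (simp add: factor_simple_roots_def)
  \<comment> \<open>Each clause of \<open>normalized\<close> ends in one of these two alternatives,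
    and the type conditions of the clauses exhaust all cases.\<close>
  have "(\<exists>k1 \<beta>. special_normalization br \<tt> P r white \<pi> c sg h k1 \<beta>) \<or>
    (\<forall>k\<in>{1..r}. white k \<in> factor_simple_roots br \<tt> P h \<longrightarrow> sg (white k) = 1)"
    using normalized h(1) unfolding normalized_def by meson
  then show ?thesis
    using special_normalization_real k f by auto
qed

lemma simple_root_real:
  assumes "\<alpha> \<in> simple_roots P"
  shows "sg \<alpha> \<in> \<real>"
proof -
  have "\<alpha> \<in> \<Delta>"
    using assms satake by (auto simp: simple_roots_def satake_description_def positive_system_def)
  moreover have "\<alpha> \<in> white ` {1..r} \<union> black ` {1..s}"
    using assms satake by (simp add: satake_description_def)
  moreover have "\<forall>k\<in>{1..s}. \<sigma>C (sharp br \<tt> (black k)) = sharp br \<tt> (black k)"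
    using satake by (simp add: satake_description_def)
  ultimately show ?thesis
    using sg_white sg_fixed by blast
qed

text \<open>The vectors \<open>X \<alpha>\<close> are pairwise orthogonal for a definite Hermitian
  form, hence independent over the reals in a finite-dimensional space. Finiteness is what makes the
  induction on positive roots terminate.\<close>

lemma finite_roots: "finite \<Delta>"
proof -
  let ?B = "\<lambda>u v. Re (kC u (conj_cplx v))"
  have orth: "?B (X \<alpha>) (X \<beta>) = 0" if "\<alpha> \<in> \<Delta>" "\<beta> \<in> \<Delta>" "\<alpha> \<noteq> \<beta>" for \<alpha> \<beta>
    using kC_X[OF that(1) root_uminus[OF that(2)]] that by (simp add: conj_X kC_minus_right)
  have neg: "?B (X \<alpha>) (X \<alpha>) \<noteq> 0" if "\<alpha> \<in> \<Delta>" for \<alpha>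
    using kC_conj_self_neg(1)[OF X_neq_0[OF that]] by simp
  have inj: "inj_on X \<Delta>"
    using orth neg by (metis inj_onI)
  have lin: "linear (\<lambda>u. ?B u v)" for v
    by (intro linearI) (simp_all add: killing_cplx_def killing_linear algebra_simps)
  have "independent (X ` \<Delta>)"
    unfolding independent_explicit_finite_subsets
  proof (intro allI impI ballI)
    fix S u v
    assume S: "S \<subseteq> X ` \<Delta>" "finite S" "(\<Sum>w\<in>S. u w *\<^sub>R w) = 0" "v \<in> S"
    have "0 = ?B (\<Sum>w\<in>S. u w *\<^sub>R w) v"
      by (simp add: S(3))
    also have "\<dots> = (\<Sum>w\<in>S. u w * ?B w v)"
      using linear_sum[OF lin[of v], of "\<lambda>w. u w *\<^sub>R w" S] linear_scale[OF lin[of v]] by simp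
    also have "\<dots> = (\<Sum>w\<in>{v}. u w * ?B w v)"
    proof (rule sum.mono_neutral_right[OF S(2)])
      show "\<forall>w\<in>S - {v}. u w * ?B w v = 0"
      proof
        fix w
        assume w: "w \<in> S - {v}"
        then obtain \<alpha> \<beta> where "\<alpha> \<in> \<Delta>" "\<beta> \<in> \<Delta>" "w = X \<alpha>" "v = X \<beta>"
          using S(1,4) by blast
        with w orth[of \<alpha> \<beta>] show "u w * ?B w v = 0"
          by auto
      qed
    qed (use S(4) in simp)
    finally show "u v = 0"
      using neg S(1,4) by auto
  qed
  then show ?thesis
    using independent_imp_finite finite_imageD[OF _ inj] by blast
qed

lemma positive_root_real:
  assumes "\<alpha> \<in> P"
  shows "sg \<alpha> \<in> \<real>"
proof -
  obtain H where H: "H \<in> \<tt>" and P: "P = {\<alpha>\<in>\<Delta>. 0 < Re (\<alpha> (0, H))}"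
    using satake by (auto simp: satake_description_def positive_system_def)
  define ht where "ht \<alpha> = Re (\<alpha> (0, H))" for \<alpha> :: "'g form"
  have fin: "finite P"
    using finite_roots P by simp
  show ?thesis
    using assms
  \<comment> \<open>The height is the value at the regular element and need not be an integer, so
    the induction runs on the number of positive roots of smaller height.\<close>
  proof (induction "card {\<gamma>\<in>P. ht \<gamma> < ht \<alpha>}" arbitrary: \<alpha> rule: less_induct)
    case less
    show ?case
    proof (cases "\<alpha> \<in> simple_roots P")
      case True
      then show ?thesis by (rule simple_root_real)
    next
      case False
      let ?z = "\<zeta> \<alpha>" and ?e = "\<eta> \<alpha>"
      have ze: "?z \<in> P" "?e \<in> P" "\<alpha> = ?z + ?e" "c ?z ?e > 0"
        using positive_split[of \<alpha>] False less.prems by auto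
      have "ht \<alpha> = ht ?z + ht ?e"
        using ze(3) unfolding ht_def by (metis plus_complex.sel(1) plus_fun_apply)
      moreover have "ht ?z > 0" "ht ?e > 0"
        using ze(1,2) P by (auto simp: ht_def)
      ultimately have lt: "ht ?z < ht \<alpha>" "ht ?e < ht \<alpha>"
        by simp_all
      have IH: "sg \<gamma> \<in> \<real>" if "\<gamma> \<in> P" "ht \<gamma> < ht \<alpha>" for \<gamma>
      proof (rule less.hyps[OF _ that(1)])
        show "card {\<delta>\<in>P. ht \<delta> < ht \<gamma>} < card {\<delta>\<in>P. ht \<delta> < ht \<alpha>}"
          using fin that by (intro psubset_card_mono) force+
      qed
      have "complex_of_real (c ?z ?e) * sg \<alpha> = sg ?z * sg ?e * complex_of_real (c (act \<sigma> ?z) (act \<sigma> ?e))"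
        using sg_add[of ?z ?e] ze less.prems P by auto
      then have "sg \<alpha> = sg ?z * sg ?e * complex_of_real (c (act \<sigma> ?z) (act \<sigma> ?e)) / complex_of_real (c ?z ?e)"
        using ze(4) by (simp add: field_simps)
      then show ?thesis
        using IH[OF ze(1) lt(1)] IH[OF ze(2) lt(2)] by (metis Reals_divide Reals_mult Reals_of_real)
    qed
  qed
qed

text \<open>A root is real and nonzero at the regular element i H, so \<alpha> or -\<alpha> is
  positive; the second case reduces to the first by \<open>sg_uminus\<close>.\<close>

lemma sg_real:
  assumes "\<alpha> \<in> \<Delta>"
  shows "cnj (sg \<alpha>) = sg \<alpha>"
proof -
  obtain H where H: "H \<in> \<tt>" "\<forall>\<alpha>\<in>\<Delta>. \<alpha> (0, H) \<noteq> 0" and P: "P = {\<alpha>\<in>\<Delta>. 0 < Re (\<alpha> (0, H))}"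
    using satake by (auto simp: satake_description_def positive_system_def)
  have iH: "(0, H) = \<i> *\<^sub>C emb H"
    by (simp add: prod_eq_iff)
  have "emb H \<in> \<tt> \<times> \<tt>"
    using H(1) subspace_0[OF subspace_cartan] by (simp add: emb_def)
  then have "\<alpha> (0, H) = \<i> * \<alpha> (emb H)"
    unfolding iH by (rule forms_scaleD[OF root_forms[OF assms]])
  then have "Im (\<alpha> (0, H)) = 0"
    using root_imaginary[OF assms H(1)] by (simp add: complex_eq_iff)
  then have "Re (\<alpha> (0, H)) \<noteq> 0"
    using H(2) assms by (auto simp: complex_eq_iff)
  then have "\<alpha> \<in> P \<or> - \<alpha> \<in> P"
    using assms root_uminus[OF assms] by (auto simp: P)
  then show ?thesis
  proof
    assume "\<alpha> \<in> P"
    then show ?thesis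
      using positive_root_real Reals_cnj_iff by blast
  next
    assume "- \<alpha> \<in> P"
    then have "cnj (sg (- \<alpha>)) = sg (- \<alpha>)"
      using positive_root_real Reals_cnj_iff by blast
    then show ?thesis
      by (simp add: sg_uminus[OF assms])
  qed
qed

text \<open>The coefficients of the two root vectors acquire s_\<alpha> and its conjugate; reality
  allows them to be factored out together.\<close>

lemma \<sigma>C_V:
  assumes "\<alpha> \<in> \<Delta>"
  shows "\<sigma>C (VX \<alpha> z) = sg \<alpha> *\<^sub>C VX (act \<sigma> \<alpha>) z"
  using lin_X[OF assms] lin_X[OF root_uminus[OF assms]]
  by (simp add: V_root[OF assms] V_root[OF act_root[OF assms]] \<sigma>C_scale \<sigma>C_diff act_uminus
      sg_uminus[OF assms] sg_real[OF assms] cplx.scale_right_diff_distrib mult.commute mult.left_commute)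

end

section \<open>Assembly of the claims (a) to (d)\<close>

theorem proposition5p1:
  fixes br :: "'g::euclidean_space \<Rightarrow> 'g \<Rightarrow> 'g"
    and \<sigma> :: "'g \<Rightarrow> 'g"
    and \<aa> \<tt> :: "'g set"
    and P :: "'g form set"
    and r s :: nat
    and white black :: "nat \<Rightarrow> 'g form"
    and \<pi> :: "nat \<Rightarrow> nat"
    and n :: "nat \<Rightarrow> nat \<Rightarrow> nat"
    and X :: "'g form \<Rightarrow> 'g cplx"
    and c :: "'g form \<Rightarrow> 'g form \<Rightarrow> real"
    and \<zeta> \<eta> :: "'g form \<Rightarrow> 'g form"
    and sg :: "'g form \<Rightarrow> complex"
    and \<alpha> \<beta> :: "'g form"
  assumes "compact_symmetric_lie_algebra br \<sigma>"
    and "maximal_abelian_in br {x. \<sigma> x = - x} \<aa>"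
    and "cartan_subalgebra br \<tt>" and "\<aa> \<subseteq> \<tt>"
    and "satake_description br \<sigma> \<tt> P r s white black \<pi> n"
    and "chevalley_basis br \<tt> P X c \<zeta> \<eta>"
    and "\<And>\<gamma>. \<gamma> \<in> roots br \<tt> \<Longrightarrow> lin_cplx \<sigma> (X \<gamma>) = sg \<gamma> *\<^sub>C X (act \<sigma> \<gamma>)"
    and "normalized br \<sigma> \<tt> P r s white black \<pi> c sg"
    and "\<alpha> \<in> roots br \<tt>" and "\<beta> \<in> roots br \<tt>"
  shows
    "emb ` root_space br \<tt> \<alpha> = {V br \<tt> X \<alpha> z | z. True} \<and>
     (\<forall>H\<in>\<tt>. \<forall>z. br_cplx br (emb H) (V br \<tt> X \<alpha> z) = V br \<tt> X \<alpha> (\<alpha> (emb H) * z)) \<and>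
     (\<forall>z z'. br_cplx br (V br \<tt> X \<alpha> z) (V br \<tt> X \<beta> z') =
        (if \<beta> \<notin> {\<alpha>, - \<alpha>} then
           complex_of_real (1 / sqrt 2) *\<^sub>C
             (complex_of_real (c \<alpha> \<beta>) *\<^sub>C V br \<tt> X (\<alpha> + \<beta>) (z * z')
              - complex_of_real (c \<alpha> (- \<beta>)) *\<^sub>C V br \<tt> X (\<alpha> - \<beta>) (z * cnj z'))
         else if \<beta> = \<alpha> then complex_of_real (Im (cnj z * z')) *\<^sub>C (\<i> *\<^sub>C sharp br \<tt> \<alpha>)
         else complex_of_real (Im (z * z')) *\<^sub>C (\<i> *\<^sub>C sharp br \<tt> \<alpha>))) \<and>
     (\<forall>H\<in>\<tt>. \<forall>Y\<in>root_space br \<tt> \<alpha>. - killing br H Y = 0) \<and>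
     (\<alpha> \<notin> {\<beta>, - \<beta>} \<longrightarrow>
        (\<forall>Y\<in>root_space br \<tt> \<alpha>. \<forall>Z\<in>root_space br \<tt> \<beta>. - killing br Y Z = 0)) \<and>
     (\<forall>z z'. - killing_cplx br (V br \<tt> X \<alpha> z) (V br \<tt> X \<alpha> z') = complex_of_real (Re (z * cnj z'))) \<and>
     (\<forall>z. lin_cplx \<sigma> (V br \<tt> X \<alpha> z) = sg \<alpha> *\<^sub>C V br \<tt> X (act \<sigma> \<alpha>) z)"
proof -
  interpret compact_symmetric_chevalley br \<tt> P X c \<zeta> \<eta> \<sigma> \<aa> r s white black \<pi> n sg
    using assms(1-8) by unfold_locales (auto simp: compact_symmetric_lie_algebra_def)
  note \<alpha> = assms(9) and \<beta> = assms(10)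
  show ?thesis
  proof (intro conjI allI ballI impI)
    show "emb ` root_space br \<tt> \<alpha> = {VX \<alpha> z | z. True}"
      by (rule root_space_eq_V[OF \<alpha>])
    show "brC (emb H) (VX \<alpha> z) = VX \<alpha> (\<alpha> (emb H) * z)" if "H \<in> \<tt>" for H z
      by (rule brC_cartan_V[OF \<alpha> that])
    show "brC (VX \<alpha> z) (VX \<beta> z') =
        (if \<beta> \<notin> {\<alpha>, - \<alpha>} then
           complex_of_real (1 / sqrt 2) *\<^sub>C
             (complex_of_real (c \<alpha> \<beta>) *\<^sub>C VX (\<alpha> + \<beta>) (z * z')
              - complex_of_real (c \<alpha> (- \<beta>)) *\<^sub>C VX (\<alpha> - \<beta>) (z * cnj z'))
         else if \<beta> = \<alpha> then complex_of_real (Im (cnj z * z')) *\<^sub>C (\<i> *\<^sub>C sharp br \<tt> \<alpha>)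
         else complex_of_real (Im (z * z')) *\<^sub>C (\<i> *\<^sub>C sharp br \<tt> \<alpha>))" for z z'
      using brC_V[OF \<alpha> \<beta>] brC_V_self[OF \<alpha>] brC_V_uminus[OF \<alpha>]
      by (cases "\<beta> = \<alpha>"; cases "\<beta> = - \<alpha>") (simp_all only: insert_iff empty_iff if_True if_False simp_thms)
    show "- killing br H Y = 0" if "H \<in> \<tt>" "Y \<in> root_space br \<tt> \<alpha>" for H Y
      using killing_cartan_root_space[OF \<alpha> that] by simp
    show "- killing br Y Z = 0"
      if "\<alpha> \<notin> {\<beta>, - \<beta>}" "Y \<in> root_space br \<tt> \<alpha>" "Z \<in> root_space br \<tt> \<beta>" for Y Z
      using killing_root_spaces[OF \<alpha> \<beta>] that by simp
    show "- kC (VX \<alpha> z) (VX \<alpha> z') = complex_of_real (Re (z * cnj z'))" for z z'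
      by (rule kC_V[OF \<alpha>])
    show "\<sigma>C (VX \<alpha> z) = sg \<alpha> *\<^sub>C VX (act \<sigma> \<alpha>) z" for z
      by (rule \<sigma>C_V[OF \<alpha>])
  qed
qed

end
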